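(* Let $p(\cdot)\in\mathcal{P}(\mathbb{R}^n)$ with $p_+\in(0,1]$, $q\in[1,\infty)$, $\eta\in(0,1]$, and $s\in\mathbb{Z}_+$. Then $$\mathcal{L}_{p(\cdot),q,s,\eta}^A(\mathbb{R}^n)=\mathcal{L}_{p(\cdot),q,s}^A(\mathbb{R}^n)$$ with equivalent quasi-norms.
   Context: Dilations. $A$ is a fixed real $n\times n$ expansive matrix (dilation), i.e. all eigenvalues $\lambda$ of $A$ satisfy $|\lambda|>1$; $b:=|\det A|\in(1,\infty)$. Fix an open ellipsoid $\Delta$ centred at the origin with $|\Delta|=1$ and a number $r_0\in(1,\infty)$ with $\Delta\subset r_0\Delta\subset A\Delta$ (these exist). For $k\in\mathbb{Z}$ put $B_k:=A^k\Delta$, so $|B_k|=b^k$. The family of dilated balls is $\mathfrak{B}:=\{x+B_k:\ x\in\mathbb{R}^n,\ k\in\mathbb{Z}\}$. $\mathbb{Z}_+:=\{0,1,2,\dots\}$. Variable exponents. $\mathcal{P}(\mathbb{R}^n)$ is the set of measurable $p(\cdot):\mathbb{R}^n\to(0,\infty]$ with $0<p_-:=\operatorname{ess\,inf}p\le\operatorname{ess\,sup}p=:p_+<\infty$. $L^{p(\cdot)}(\mathbb{R}^n)$ is the variable Lebesgue space with quasi-norm $\|f\|_{L^{p(\cdot)}(\mathbb{R}^n)}:=\inf\{\lambda\in(0,\infty):\int_{\mathbb{R}^n}(|f(x)|/\lambda)^{p(x)}\,dx\le1\}$. Campanato-type space. $\mathbb{P}_s(\mathbb{R}^n)$ is the set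 of polynomials on $\mathbb{R}^n$ of degree at most $s$. For $B\in\mathfrak{B}$ and locally integrable $g$, $P_B^sg$ is the unique $f\in\mathbb{P}_s(\mathbb{R}^n)$ with $\int_B[g(x)-f(x)]h(x)\,dx=0$ for all $h\in\mathbb{P}_s(\mathbb{R}^n)$. For $q\in[1,\infty)$, $\eta\in(0,\infty)$, $s\in\mathbb{Z}_+$, the anisotropic variable Campanato-type space $\mathcal{L}_{p(\cdot),q,s,\eta}^A(\mathbb{R}^n)$ is the set of $f\in L^q_{\mathrm{loc}}(\mathbb{R}^n)$ with $$\|f\|_{\mathcal{L}_{p(\cdot),q,s,\eta}^A(\mathbb{R}^n)}:=\sup\left\|\left\{\sum_{i=1}^m\left[\frac{\lambda_i}{\|\mathbf{1}_{B^{(i)}}\|_{L^{p(\cdot)}(\mathbb{R}^n)}}\right]^\eta\mathbf{1}_{B^{(i)}}\right\}^{1/\eta}\right\|_{L^{p(\cdot)}(\mathbb{R}^n)}^{-1}\sum_{j=1}^m\frac{\lambda_j|B^{(j)}|}{\|\mathbf{1}_{B^{(j)}}\|_{L^{p(\cdot)}(\mathbb{R}^n)}}\left[\frac1{|B^{(j)}|}\int_{B^{(j)}}|f(x)-P^s_{B^{(j)}}f(x)|^q\,dx\right]^{1/q}<\infty,$$ the supremum being over all $m\in\mathbb{N}$, $\{B^{(j)}\}_{j=1}^m\subset\mathfrak{B}$ and $\{\lambda_j\}_{j=1}^m\subset[0,\infty)$ with $\sum_{j=1}^m\lambda_j\neq0$. Campanato space. The anisotropic variable Campanato space $\mathcal{L}_{p(\cdot),q,s}^A(\mathbb{R}^n)$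 is the set of $f\in L^q_{\mathrm{loc}}(\mathbb{R}^n)$ with $$\|f\|_{\mathcal{L}_{p(\cdot),q,s}^A(\mathbb{R}^n)}:=\sup_{B\in\mathfrak{B}}\inf_{P\in\mathbb{P}_s(\mathbb{R}^n)}\frac{|B|}{\|\mathbf{1}_B\|_{L^{p(\cdot)}(\mathbb{R}^n)}}\left[\frac1{|B|}\int_B|f(x)-P(x)|^q\,dx\right]^{1/q}<\infty.$$ *)

theory Defs
  imports "HOL-Probability.Essential_Supremum"
begin

section \<open>Dilations and dilated balls\<close>

text \<open>Eigenvalues of a real matrix are its complex eigenvalues, hence the complexification.\<close>

definition expansive :: "real^'n^'n \<Rightarrow> bool" where
  "expansive A \<longleftrightarrow>
     (\<forall>\<mu>::complex. (\<exists>v::complex^'n. v \<noteq> 0 \<and> map_matrix complex_of_real A *v v = \<mu> *s v)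
        \<longrightarrow> cmod \<mu> > 1)"

definition centred_open_ellipsoid :: "(real^'n) set \<Rightarrow> bool" where
  "centred_open_ellipsoid \<Delta> \<longleftrightarrow> (\<exists>P::real^'n^'n. invertible P \<and> \<Delta> = {x. norm (P *v x) < 1})"

definition dilation_setting :: "real^'n^'n \<Rightarrow> (real^'n) set \<Rightarrow> real \<Rightarrow> bool" where
  "dilation_setting A \<Delta> r\<^sub>0 \<longleftrightarrow>
     expansive A \<and> centred_open_ellipsoid \<Delta> \<and> measure lebesgue \<Delta> = 1 \<and> 1 < r\<^sub>0 \<and>
     \<Delta> \<subseteq> (\<lambda>x. r\<^sub>0 *\<^sub>R x) ` \<Delta> \<and> (\<lambda>x. r\<^sub>0 *\<^sub>R x) ` \<Delta> \<subseteq> (\<lambda>x. A *v x) ` \<Delta>"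

text \<open>The action of the integer matrix power \<open>A\<^sup>k\<close> on vectors.\<close>

definition dil_pow :: "real^'n^'n \<Rightarrow> int \<Rightarrow> real^'n \<Rightarrow> real^'n" where
  "dil_pow A k = (if 0 \<le> k then ((*v) A) ^^ nat k else ((*v) (matrix_inv A)) ^^ nat (- k))"

definition dil_balls :: "real^'n^'n \<Rightarrow> (real^'n) set \<Rightarrow> (real^'n) set set" where
  "dil_balls A \<Delta> = {(\<lambda>y. x + y) ` (dil_pow A k ` \<Delta>) | x k. True}"

section \<open>Variable Lebesgue spaces\<close>

definition p_plus :: "(real^'n \<Rightarrow> ereal) \<Rightarrow> ereal" where
  "p_plus p = esssup lebesgue p"

text \<open>The essential infimum, as minus the essential supremum of \<open>- p\<close>.\<close>

definition p_minus :: "(real^'n \<Rightarrow> ereal) \<Rightarrow> ereal" where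
  "p_minus p = - esssup lebesgue (\<lambda>x. - p x)"

definition variable_exponents :: "(real^'n \<Rightarrow> ereal) set" where
  "variable_exponents = {p. p \<in> borel_measurable lebesgue \<and> (\<forall>x. 0 < p x) \<and>
     0 < p_minus p \<and> p_minus p \<le> p_plus p \<and> p_plus p < \<infinity>}"

text \<open>For \<open>p\<close> in \<^const>\<open>variable_exponents\<close> the set where \<open>p = \<infinity>\<close> is null, so the junk value of
  \<^const>\<open>real_of_ereal\<close> there is irrelevant. The infimum over the empty set is \<open>\<infinity>\<close>.\<close>

definition varLp_norm :: "(real^'n \<Rightarrow> ereal) \<Rightarrow> (real^'n \<Rightarrow> 'b::real_normed_vector) \<Rightarrow> ennreal" where
  "varLp_norm p f = Inf {ennreal t | t::real. 0 < t \<and>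
     (\<integral>\<^sup>+x. ennreal ((norm (f x) / t) powr real_of_ereal (p x)) \<partial>lebesgue) \<le> 1}"

text \<open>The quasi-norm of the indicator of \<open>B\<close> as a real number; for dilated balls it is finite and
  positive, so no information is lost by the conversion.\<close>

definition ind_norm :: "(real^'n \<Rightarrow> ereal) \<Rightarrow> (real^'n) set \<Rightarrow> real" where
  "ind_norm p B = enn2real (varLp_norm p (indicat_real B))"

section \<open>Polynomials and local integrability\<close>

text \<open>From here on functions take values in a type \<open>'a\<close> of scalars, which covers both the real
  and the complex numbers; polynomials have coefficients in the same \<open>'a\<close>.\<close>

definition polys :: "nat \<Rightarrow> (real^'n \<Rightarrow> 'a::{real_normed_field,euclidean_space}) set" where
  "polys s = {f. \<exists>c :: ('n \<Rightarrow> nat) \<Rightarrow> 'a.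
     f = (\<lambda>x. \<Sum>\<alpha> | (\<Sum>i\<in>UNIV. \<alpha> i) \<le> s. c \<alpha> * of_real (\<Prod>i\<in>UNIV. (x $ i) ^ \<alpha> i))}"

definition Lq_loc :: "real \<Rightarrow> (real^'n \<Rightarrow> 'a::{real_normed_field,euclidean_space}) set" where
  "Lq_loc q = {f. f \<in> borel_measurable lebesgue \<and>
     (\<forall>K. compact K \<longrightarrow> set_integrable lebesgue K (\<lambda>x. norm (f x) powr q))}"

definition poly_proj ::
  "nat \<Rightarrow> (real^'n) set \<Rightarrow> (real^'n \<Rightarrow> 'a::{real_normed_field,euclidean_space}) \<Rightarrow> real^'n \<Rightarrow> 'a" where
  "poly_proj s B g = (THE f. f \<in> polys s \<and>
     (\<forall>h\<in>polys s. (LINT x:B|lebesgue. (g x - f x) * h x) = 0))"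

definition Lq_mean ::
  "real \<Rightarrow> (real^'n) set \<Rightarrow> (real^'n \<Rightarrow> 'a::{real_normed_field,euclidean_space}) \<Rightarrow> real" where
  "Lq_mean q B g =
     (1 / measure lebesgue B * (LINT x:B|lebesgue. norm (g x) powr q)) powr (1 / q)"

section \<open>The two Campanato spaces\<close>

text \<open>The quasi-norms take values in \<open>[0, \<infinity>]\<close>. They are meaningful for \<open>f\<close> in \<^term>\<open>Lq_loc q\<close> only,
  where the integrals in \<^const>\<open>Lq_mean\<close> exist.\<close>

definition campanato_type_norm ::
  "real^'n^'n \<Rightarrow> (real^'n) set \<Rightarrow> (real^'n \<Rightarrow> ereal) \<Rightarrow> real \<Rightarrow> nat \<Rightarrow> real
    \<Rightarrow> (real^'n \<Rightarrow> 'a::{real_normed_field,euclidean_space}) \<Rightarrow> ennreal" where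
  "campanato_type_norm A \<Delta> p q s \<eta> f = Sup
     {inverse (varLp_norm p (\<lambda>x.
         (\<Sum>i=1..m. (lam i / ind_norm p (B i)) powr \<eta> * indicat_real (B i) x) powr (1 / \<eta>))) *
      ennreal (\<Sum>j=1..m. lam j * measure lebesgue (B j) / ind_norm p (B j) *
         Lq_mean q (B j) (\<lambda>x. f x - poly_proj s (B j) f x))
      | (m::nat) (B :: nat \<Rightarrow> (real^'n) set) (lam :: nat \<Rightarrow> real).
        (\<forall>j\<in>{1..m}. B j \<in> dil_balls A \<Delta>) \<and> (\<forall>j\<in>{1..m}. 0 \<le> lam j) \<and> (\<Sum>j=1..m. lam j) \<noteq> 0}"

definition campanato_type_space ::
  "real^'n^'n \<Rightarrow> (real^'n) set \<Rightarrow> (real^'n \<Rightarrow> ereal) \<Rightarrow> real \<Rightarrow> nat \<Rightarrow> real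
    \<Rightarrow> (real^'n \<Rightarrow> 'a::{real_normed_field,euclidean_space}) set" where
  "campanato_type_space A \<Delta> p q s \<eta> = {f \<in> Lq_loc q. campanato_type_norm A \<Delta> p q s \<eta> f < \<infinity>}"

definition campanato_norm ::
  "real^'n^'n \<Rightarrow> (real^'n) set \<Rightarrow> (real^'n \<Rightarrow> ereal) \<Rightarrow> real \<Rightarrow> nat
    \<Rightarrow> (real^'n \<Rightarrow> 'a::{real_normed_field,euclidean_space}) \<Rightarrow> ennreal" where
  "campanato_norm A \<Delta> p q s f =
     (SUP B\<in>dil_balls A \<Delta>. INF P\<in>polys s.
        ennreal (measure lebesgue B / ind_norm p B * Lq_mean q B (\<lambda>x. f x - P x)))"

definition campanato_space ::
  "real^'n^'n \<Rightarrow> (real^'n) set \<Rightarrow> (real^'n \<Rightarrow> ereal) \<Rightarrow> real \<Rightarrow> nat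
    \<Rightarrow> (real^'n \<Rightarrow> 'a::{real_normed_field,euclidean_space}) set" where
  "campanato_space A \<Delta> p q s = {f \<in> Lq_loc q. campanato_norm A \<Delta> p q s f < \<infinity>}"

end

theory Submission
  imports Defs
begin

text \<open>The Campanato-type norm is a supremum over finite families of balls \<open>B\<^sub>j\<close> with coefficients \<open>\<lambda>\<^sub>j\<close>. A family
  with a single ball and coefficient one has denominator at most one and numerator the oscillation of \<open>f\<close> on that ball
  about its polynomial projection, which is at least the infimum over all polynomials
  (\<open>campanato_norm_le_type_norm\<close>). So the Campanato norm is the smaller one, with constant one.

  For the converse there are two points. First, the exponent is at most one, so the \<open>p\<close>-th power is concave and the
  variable Lebesgue quasi-norm is superadditive on nonnegative functions. Together with \<open>\<eta> \<le> 1\<close> this bounds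
  \<open>\<Sum>\<^sub>j \<lambda>\<^sub>j\<close> by the denominator (\<open>sum_le_varLp_norm\<close>), and the quotient becomes at most a weighted mean of the
  oscillations on single balls. Second, the projection is a near-best approximation in the \<open>q\<close>-mean, with a constant that
  is the same for all balls (\<open>poly_proj_near_best\<close>).

  The uniformity comes from affine invariance. All dilated balls are ellipsoids (\<open>dil_balls_ellipsoid\<close>), that is,
  affine images of the unit ball, and both polynomials of degree at most \<open>s\<close> and normalised averages are carried along by
  affine maps. An orthonormal basis of polynomials on the unit ball therefore yields one on every ellipsoid, with the same
  bound on its members (\<open>uniformly_bounded_orthonormal_bases\<close>). The projection is the Fourier sum in this basis
  (\<open>poly_proj_eq_Fourier_sum\<close>), so that it exists, fixes polynomials and is bounded uniformly.\<close>

section \<open>Variable Lebesgue norms for exponents at most one\<close>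

locale exponent_at_most_one =
  fixes p :: "real^'n \<Rightarrow> ereal" and a :: real
  assumes measurable_exponent: "p \<in> borel_measurable lebesgue"
    and exponent_nonneg: "\<And>x. 0 \<le> p x"
    and a_pos: "0 < a"
    and AE_exponent: "AE x in lebesgue. a \<le> real_of_ereal (p x) \<and> real_of_ereal (p x) \<le> 1"
begin

text \<open>The infimum defining the quasi-norm runs over the \<open>t\<close> with
  \<open>modular f t \<le> 1\<close>, so estimates of norms are proved as estimates of modulars.\<close>

definition modular :: "(real^'n \<Rightarrow> real) \<Rightarrow> real \<Rightarrow> ennreal" where
  "modular f t = (\<integral>\<^sup>+x. ennreal ((norm (f x) / t) powr real_of_ereal (p x)) \<partial>lebesgue)"

lemma measurable_real_exponent [measurable]: "(\<lambda>x. real_of_ereal (p x)) \<in> borel_measurable lebesgue"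
  using measurable_exponent by measurable

lemma varLp_norm_eq: "varLp_norm p f = Inf {ennreal t | t. 0 < t \<and> modular f t \<le> 1}"
  unfolding varLp_norm_def modular_def ..

lemma varLp_norm_le: "0 < t \<Longrightarrow> modular f t \<le> 1 \<Longrightarrow> varLp_norm p f \<le> ennreal t"
  unfolding varLp_norm_eq by (rule Inf_lower) auto

lemma modular_antimono:
  assumes "0 < s" "s \<le> t" shows "modular f t \<le> modular f s"
  unfolding modular_def using assms exponent_nonneg
  by (intro nn_integral_mono ennreal_leI powr_mono2 divide_left_mono) (auto intro: real_of_ereal_pos)

lemma modular_le_one:
  assumes "varLp_norm p f < ennreal t" shows "modular f t \<le> 1"
proof -
  from assms obtain s where s: "0 < s" "modular f s \<le> 1" "ennreal s < ennreal t"
    unfolding varLp_norm_eq Inf_less_iff by auto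
  have "s \<le> t" using s by (simp add: ennreal_less_iff)
  with s show ?thesis using modular_antimono[of s t f] by (auto intro: order_trans)
qed

lemma modular_scale: "0 < c \<Longrightarrow> modular (\<lambda>x. f x / c) t = modular f (c * t)"
  unfolding modular_def by (simp add: field_simps)

text \<open>The modular of an indicator is at most \<open>t powr (-a) * |B|\<close> for \<open>t \<ge> 1\<close> and at least this for
  \<open>t \<le> 1\<close>: almost everywhere the exponent is at least \<open>a\<close>, which is the worst case in both ranges. Hence some \<open>t\<close> is admissible, and no small one is.\<close>

lemma varLp_norm_indicator:
  assumes "B \<in> lmeasurable" "0 < measure lebesgue B"
  shows "varLp_norm p (indicat_real B) = ennreal (ind_norm p B)" and "0 < ind_norm p B"
proof -
  let ?m = "measure lebesgue B"
  have B: "B \<in> sets lebesgue" "emeasure lebesgue B = ennreal ?m"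
    using assms by (auto simp: emeasure_eq_measure2)
  have const: "(\<integral>\<^sup>+x. ennreal c * indicator B x \<partial>lebesgue) = ennreal (c * ?m)" if "0 \<le> c" for c
    using B that by (simp add: nn_integral_cmult_indicator ennreal_mult)
  have up: "modular (indicat_real B) t \<le> ennreal (t powr (-a) * ?m)" if "1 \<le> t" for t
  proof -
    have "modular (indicat_real B) t \<le> (\<integral>\<^sup>+x. ennreal (t powr (-a)) * indicator B x \<partial>lebesgue)"
      unfolding modular_def
    proof (intro nn_integral_mono_AE)
      show "AE x in lebesgue. ennreal ((norm (indicat_real B x) / t) powr real_of_ereal (p x))
             \<le> ennreal (t powr - a) * indicator B x"
        using AE_exponent
      proof eventually_elim
        case (elim x)
        have "(1 / t) powr real_of_ereal (p x) \<le> (1/t) powr a"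
          using elim that by (intro powr_mono') auto
        also have "\<dots> = t powr (-a)" using that by (simp add: powr_divide powr_minus_divide)
        finally show ?case by (auto simp: indicator_def intro!: ennreal_leI)
      qed
    qed
    with const show ?thesis by simp
  qed
  have low: "ennreal (t powr (-a) * ?m) \<le> modular (indicat_real B) t" if "0 < t" "t \<le> 1" for t
  proof -
    have "(\<integral>\<^sup>+x. ennreal (t powr (-a)) * indicator B x \<partial>lebesgue) \<le> modular (indicat_real B) t"
      unfolding modular_def
    proof (intro nn_integral_mono_AE)
      show "AE x in lebesgue. ennreal (t powr - a) * indicator B x
             \<le> ennreal ((norm (indicat_real B x) / t) powr real_of_ereal (p x))"
        using AE_exponent
      proof eventually_elim
        case (elim x)
        have "t powr (-a) = (1/t) powr a" using that by (simp add: powr_divide powr_minus_divide)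
        also have "(1 / t) powr a \<le> (1/t) powr real_of_ereal (p x)"
          using elim that by (intro powr_mono) auto
        finally show ?case by (auto simp: indicator_def intro!: ennreal_leI)
      qed
    qed
    with const show ?thesis by simp
  qed
  obtain T where T: "1 \<le> T" "T powr (-a) * ?m \<le> 1"
  proof
    let ?T = "max 1 (?m powr (1/a))"
    show "1 \<le> ?T" by simp
    have "?m = (?m powr (1/a)) powr a" using assms a_pos by (simp add: powr_powr)
    also have "\<dots> \<le> ?T powr a" using a_pos by (intro powr_mono2) auto
    finally show "?T powr (-a) * ?m \<le> 1" by (simp add: powr_minus field_simps)
  qed
  obtain d where d: "0 < d" "d \<le> 1" "1 < d powr (-a) * ?m"
  proof
    let ?d = "min 1 ((?m/2) powr (1/a))"
    show d0: "0 < ?d" "?d \<le> 1" using assms by auto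
    have "?d powr a \<le> ((?m/2) powr (1/a)) powr a" using a_pos assms by (intro powr_mono2) auto
    also have "\<dots> < ?m" using assms a_pos by (simp add: powr_powr)
    finally have "?d powr a < ?m" .
    moreover have "0 < ?d powr a" using d0 by (metis powr_gt_zero less_irrefl)
    ultimately have "1 < inverse (?d powr a) * ?m"
      by (metis mult.commute divide_inverse less_divide_eq_1_pos)
    then show "1 < ?d powr (-a) * ?m" by (simp only: powr_minus)
  qed
  have "varLp_norm p (indicat_real B) \<le> ennreal T"
    using up[OF T(1)] T by (intro varLp_norm_le) (auto intro: order_trans simp: ennreal_le_1)
  then have fin: "varLp_norm p (indicat_real B) < top" using ennreal_less_top le_less_trans by blast
  then show eq: "varLp_norm p (indicat_real B) = ennreal (ind_norm p B)"
    unfolding ind_norm_def by simp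
  have "\<not> varLp_norm p (indicat_real B) < ennreal d"
  proof
    assume "varLp_norm p (indicat_real B) < ennreal d"
    then have "modular (indicat_real B) d \<le> 1" by (rule modular_le_one)
    then have "ennreal (d powr (-a) * ?m) \<le> 1" using low[OF d(1,2)] by (rule order_trans[rotated])
    with d show False by (simp add: ennreal_le_1)
  qed
  then show "0 < ind_norm p B" unfolding eq using d(1)
    by (meson ennreal_less_iff less_eq_real_def not_less order_less_le_trans ennreal_leI)
qed

lemma varLp_norm_normalised_indicator:
  assumes "B \<in> lmeasurable" "0 < measure lebesgue B"
  shows "varLp_norm p (\<lambda>x. indicat_real B x / ind_norm p B) \<le> 1"
proof (rule ennreal_le_epsilon)
  note n = varLp_norm_indicator[OF assms]
  fix e :: real assume "0 < e"
  have "modular (\<lambda>x. indicat_real B x / ind_norm p B) (1 + e) \<le> 1"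
    unfolding modular_scale[OF n(2)] using n \<open>0 < e\<close>
    by (intro modular_le_one) (simp add: ennreal_less_iff)
  from varLp_norm_le[OF _ this] \<open>0 < e\<close> show "varLp_norm p (\<lambda>x. indicat_real B x / ind_norm p B) \<le> 1 + ennreal e"
    by simp
qed

text \<open>Immediate from the norm being an infimum. The estimate of sums below tests the modular only at points
  strictly below the norm, so this strict form is the one it needs.\<close>

lemma one_less_modular_indicator:
  assumes "B \<in> lmeasurable" "0 < measure lebesgue B" "0 < t" "t < ind_norm p B"
  shows "1 < modular (indicat_real B) t"
proof (rule ccontr)
  assume "\<not> ?thesis"
  then have "varLp_norm p (indicat_real B) \<le> ennreal t" using assms by (intro varLp_norm_le) auto
  then show False using assms varLp_norm_indicator[OF assms(1,2)] by simp
qed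

end

text \<open>Jensen's inequality for the concave power. With \<open>S\<close> the weighted mean of the \<open>u i\<close>, the tangent line
  at \<open>S\<close> dominates the power (an instance of Young's inequality); averaging the tangent gives the value at \<open>S\<close>.\<close>

lemma powr_sum_concave:
  fixes w u :: "'i \<Rightarrow> real"
  assumes "finite I" "\<And>i. i \<in> I \<Longrightarrow> 0 \<le> w i" "\<And>i. i \<in> I \<Longrightarrow> 0 \<le> u i" "sum w I = 1"
    and r: "0 < r" "r \<le> 1"
  shows "(\<Sum>i\<in>I. w i * u i powr r) \<le> (\<Sum>i\<in>I. w i * u i) powr r"
proof -
  let ?S = "\<Sum>i\<in>I. w i * u i"
  show ?thesis
  proof (cases "?S = 0")
    case True
    then have "\<forall>i\<in>I. w i * u i = 0"
      using assms by (subst (asm) sum_nonneg_eq_0_iff) auto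
    then have "(\<Sum>i\<in>I. w i * u i powr r) = 0" by (intro sum.neutral) auto
    then show ?thesis by simp
  next
    case False
    have S: "0 < ?S" using False assms by (simp add: sum_nonneg order_less_le)
    have "(u i) powr r \<le> ?S powr r * (1 - r) + ?S powr r * r * u i / ?S" if "i \<in> I" for i
    proof (cases "u i = 0")
      case False
      then have u: "0 < u i" using assms that by (simp add: order_less_le)
      have "(u i / ?S) powr r * 1 powr (1-r) \<le> r * (u i / ?S) + (1-r) * 1"
        using r u S by (intro Youngs_inequality_0) auto
      then have "?S powr r * (u i / ?S) powr r \<le> ?S powr r * (r * (u i / ?S) + (1-r))"
        by (intro mult_left_mono) auto
      then show ?thesis using S u by (simp add: powr_divide field_simps)
    qed (use S r in auto)
    then have "(\<Sum>i\<in>I. w i * u i powr r) \<le> (\<Sum>i\<in>I. w i * (?S powr r * (1 - r) + ?S powr r * r * u i / ?S))"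
      using assms by (intro sum_mono mult_left_mono) auto
    also have "\<dots> = (\<Sum>i\<in>I. (?S powr r * (1 - r)) * w i + (?S powr r * r / ?S) * (w i * u i))"
      by (intro sum.cong) (auto simp: algebra_simps)
    also have "\<dots> = ?S powr r * (1 - r) * sum w I + ?S powr r * r / ?S * ?S"
      by (simp only: sum.distrib sum_distrib_left)
    also have "\<dots> = ?S powr r" using S assms(4) by (simp add: algebra_simps)
    finally show ?thesis .
  qed
qed

text \<open>Write \<open>v = v^\<eta> (v^\<eta>)^(1/\<eta> - 1)\<close> and enlarge the base of the second factor to the whole sum.\<close>

lemma sum_le_powr_sum:
  fixes v :: "'i \<Rightarrow> real"
  assumes "finite I" "\<And>i. i \<in> I \<Longrightarrow> 0 \<le> v i" and \<eta>: "0 < \<eta>" "\<eta> \<le> 1"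
  shows "(\<Sum>i\<in>I. v i) \<le> (\<Sum>i\<in>I. v i powr \<eta>) powr (1/\<eta>)"
proof -
  let ?S = "\<Sum>i\<in>I. v i powr \<eta>"
  have "v i \<le> v i powr \<eta> * ?S powr (1/\<eta> - 1)" if "i \<in> I" for i
  proof -
    have "v i powr \<eta> \<le> ?S" using assms that by (intro member_le_sum) auto
    have "v i = v i powr \<eta> * (v i powr \<eta>) powr (1/\<eta> - 1)"
      using assms that by (cases "v i = 0") (auto simp: powr_powr powr_add[symmetric] algebra_simps)
    also have "\<dots> \<le> v i powr \<eta> * ?S powr (1/\<eta> - 1)"
      using \<open>v i powr \<eta> \<le> ?S\<close> \<eta> by (intro mult_left_mono powr_mono2) auto
    finally show ?thesis .
  qed
  then have "(\<Sum>i\<in>I. v i) \<le> (\<Sum>i\<in>I. v i powr \<eta> * ?S powr (1/\<eta> - 1))" by (rule sum_mono)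
  also have "\<dots> = ?S * ?S powr (1/\<eta> - 1)" by (simp add: sum_distrib_right)
  also have "\<dots> = ?S powr (1/\<eta>)"
    using assms by (cases "?S = 0") (auto simp: powr_diff sum_nonneg)
  finally show ?thesis .
qed

context exponent_at_most_one
begin

text \<open>The quasi-norm is superadditive on nonnegative functions when the exponent is at most one, since
  the power is then concave. For \<open>t\<close> below \<open>\<Lambda> = sum lam I\<close>, divide the sum by \<open>t\<close> and read it as a convex
  combination, with weights \<open>lam i / \<Lambda>\<close>, of indicators rescaled to have norm larger than one. By concavity
  the modular of the combination dominates the convex combination of their modulars, each of which exceeds
  one; so \<open>t\<close> is not admissible. The \<open>\<eta>\<close>-sum only increases the function, as \<open>\<eta> \<le> 1\<close>.\<close>

lemma sum_le_varLp_norm: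
  fixes B :: "'i \<Rightarrow> (real^'n) set"
  assumes "finite I" and B: "\<And>i. i \<in> I \<Longrightarrow> B i \<in> lmeasurable" "\<And>i. i \<in> I \<Longrightarrow> 0 < measure lebesgue (B i)"
    and lam: "\<And>i. i \<in> I \<Longrightarrow> 0 \<le> lam i" and \<eta>: "0 < \<eta>" "\<eta> \<le> 1"
  shows "ennreal (\<Sum>i\<in>I. lam i) \<le>
    varLp_norm p (\<lambda>x. (\<Sum>i\<in>I. (lam i / ind_norm p (B i)) powr \<eta> * indicat_real (B i) x) powr (1 / \<eta>))"
    (is "ennreal ?\<Lambda> \<le> varLp_norm p ?g")
proof (cases "?\<Lambda> = 0")
  case False
  then have \<Lambda>: "0 < ?\<Lambda>" using lam by (simp add: sum_nonneg order_less_le)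
  then have ne: "I \<noteq> {}" by auto
  have n: "0 < ind_norm p (B i)" if "i \<in> I" for i
    using varLp_norm_indicator(2) B that by blast
  have "1 < modular ?g t" if t: "0 < t" "t < ?\<Lambda>" for t
  proof -
    define w where "w i = lam i / ?\<Lambda>" for i
    define u where "u i x = indicat_real (B i) x / (ind_norm p (B i) * t / ?\<Lambda>)" for i x
    have w: "\<And>i. i \<in> I \<Longrightarrow> 0 \<le> w i" "sum w I = 1"
      using lam \<Lambda> by (auto simp: w_def sum_divide_distrib[symmetric])
    have u: "0 \<le> u i x" if "i \<in> I" for i x using n[OF that] t \<Lambda> by (simp add: u_def)
    have wu: "(\<Sum>i\<in>I. w i * u i x) \<le> norm (?g x) / t" for x
    proof -
      have "(\<Sum>i\<in>I. lam i / ind_norm p (B i) * indicat_real (B i) x)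
            \<le> (\<Sum>i\<in>I. (lam i / ind_norm p (B i) * indicat_real (B i) x) powr \<eta>) powr (1/\<eta>)"
        using assms n by (intro sum_le_powr_sum) (auto simp: less_imp_le)
      also have "\<dots> = norm (?g x)"
        by (auto intro!: arg_cong2[of _ _ _ _ "(powr)"] sum.cong simp: indicator_def)
      finally have "(\<Sum>i\<in>I. lam i / ind_norm p (B i) * indicat_real (B i) x) / t \<le> norm (?g x) / t"
        using t by (intro divide_right_mono) auto
      then show ?thesis using \<Lambda> t
        by (simp add: w_def u_def sum_divide_distrib mult_ac)
    qed
    \<comment> \<open>The smallest of the finitely many modulars keeps the inequality strict after averaging.\<close>
    define \<mu> where "\<mu> = Min ((\<lambda>i. modular (indicat_real (B i)) (ind_norm p (B i) * t / ?\<Lambda>)) ` I)"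
    have "1 < modular (indicat_real (B i)) (ind_norm p (B i) * t / ?\<Lambda>)" if "i \<in> I" for i
      using n[OF that] t \<Lambda> B that by (intro one_less_modular_indicator) (auto simp: field_simps)
    then have "1 < \<mu>" unfolding \<mu>_def using assms(1) ne by (subst Min_gr_iff) auto
    also have "\<mu> = (\<Sum>i\<in>I. ennreal (w i)) * \<mu>" using w by (simp add: sum_ennreal)
    also have "\<dots> \<le> (\<Sum>i\<in>I. ennreal (w i) * modular (indicat_real (B i)) (ind_norm p (B i) * t / ?\<Lambda>))"
      unfolding sum_distrib_right \<mu>_def using assms(1) by (intro sum_mono mult_left_mono) auto
    also have "\<dots> = (\<Sum>i\<in>I. \<integral>\<^sup>+x. ennreal (w i * u i x powr real_of_ereal (p x)) \<partial>lebesgue)"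
    proof (intro sum.cong refl)
      fix i assume i: "i \<in> I"
      have [measurable]: "B i \<in> sets lebesgue" using B i by auto
      have m[measurable]: "(\<lambda>x. u i x) \<in> borel_measurable lebesgue" unfolding u_def by measurable
      have "ennreal (w i) * modular (indicat_real (B i)) (ind_norm p (B i) * t / ?\<Lambda>)
          = (\<integral>\<^sup>+x. ennreal (w i) * ennreal (u i x powr real_of_ereal (p x)) \<partial>lebesgue)"
        unfolding modular_def by (subst nn_integral_cmult) (auto simp: u_def)
      then show "ennreal (w i) * modular (indicat_real (B i)) (ind_norm p (B i) * t / ?\<Lambda>) =
         (\<integral>\<^sup>+x. ennreal (w i * u i x powr real_of_ereal (p x)) \<partial>lebesgue)"
        using w(1)[OF i] by (simp add: ennreal_mult)
    qed
    also have "\<dots> = (\<integral>\<^sup>+x. (\<Sum>i\<in>I. ennreal (w i * u i x powr real_of_ereal (p x))) \<partial>lebesgue)"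
    proof (rule nn_integral_sum[symmetric])
      fix i assume i: "i \<in> I"
      have [measurable]: "B i \<in> sets lebesgue" using B i by auto
      show "(\<lambda>x. ennreal (w i * u i x powr real_of_ereal (p x))) \<in> borel_measurable lebesgue"
        unfolding u_def by measurable
    qed
    also have "\<dots> = (\<integral>\<^sup>+x. ennreal (\<Sum>i\<in>I. w i * u i x powr real_of_ereal (p x)) \<partial>lebesgue)"
      using w by (intro nn_integral_cong sum_ennreal) auto
    also have "\<dots> \<le> modular ?g t"
      unfolding modular_def
    proof (intro nn_integral_mono_AE)
      show "AE x in lebesgue. ennreal (\<Sum>i\<in>I. w i * u i x powr real_of_ereal (p x))
          \<le> ennreal ((norm (?g x) / t) powr real_of_ereal (p x))"
        using AE_exponent
      proof eventually_elim
        case (elim x)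
        then have r: "0 < real_of_ereal (p x)" "real_of_ereal (p x) \<le> 1" using a_pos by auto
        have "(\<Sum>i\<in>I. w i * u i x powr real_of_ereal (p x)) \<le> (\<Sum>i\<in>I. w i * u i x) powr real_of_ereal (p x)"
          using assms(1) w u r by (intro powr_sum_concave) auto
        also have "\<dots> \<le> (norm (?g x) / t) powr real_of_ereal (p x)"
          using r wu w u by (intro powr_mono2) (auto intro: sum_nonneg)
        finally show ?case by (rule ennreal_leI)
      qed
    qed
    finally show ?thesis .
  qed
  then have *: "ennreal ?\<Lambda> \<le> ennreal t" if "0 < t" "modular ?g t \<le> 1" for t
    using that by (intro ennreal_leI) (meson not_less)
  show ?thesis unfolding varLp_norm_eq
    by (rule Inf_greatest) (use * in blast)
qed simp

end

lemma variable_exponents_le_one: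
  fixes p :: "real^'n \<Rightarrow> ereal"
  assumes "p \<in> variable_exponents" "p_plus p \<le> 1"
  obtains a where "exponent_at_most_one p a"
proof -
  have p: "p \<in> borel_measurable lebesgue" "\<And>x. 0 < p x" "0 < p_minus p" "p_minus p \<le> p_plus p"
    using assms unfolding variable_exponents_def by auto
  then have "p_minus p \<le> 1" using assms by auto
  then obtain a where a: "p_minus p = ereal a" "0 < a"
    using p(3) by (cases "p_minus p") auto
  have "AE x in lebesgue. a \<le> real_of_ereal (p x) \<and> real_of_ereal (p x) \<le> 1"
    using esssup_AE[of p lebesgue] esssup_AE[of "\<lambda>x. - p x" lebesgue]
  proof eventually_elim
    case (elim x)
    then have "p x \<le> 1" "p_minus p \<le> p x" using assms
      by (auto simp: p_plus_def p_minus_def ereal_uminus_le_reorder)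
    then show ?case using a p(2)[of x] by (cases "p x") auto
  qed
  with p a show ?thesis by (intro that[of a]) (unfold_locales, auto simp: less_imp_le)
qed

section \<open>Lebesgue measure under linear bijections\<close>

text \<open>Lebesgue measure is, up to a factor, the only locally finite translation invariant Borel measure, and the image of
  Lebesgue measure under \<open>L\<close> is translation invariant. With \<open>U\<close> the unit ball the computation is
  \<open>(\<integral>1\<^sub>U(Lz)dz)(\<integral>f(x)dx) = \<integral>\<integral>1\<^sub>U(Lz)f(x+Lz)dxdz = \<integral>\<integral>1\<^sub>U(Lz-x)f(Lz)dzdx = |U|\<integral>f(Lz)dz\<close>:
  translate \<open>x\<close> by \<open>Lz\<close>, exchange the integrals, translate \<open>z\<close> by the preimage of \<open>x\<close>, exchange again, and
  use that the ball is symmetric.\<close>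

lemma nn_integral_lborel_linear:
  fixes L :: "'a::euclidean_space \<Rightarrow> 'a"
  assumes "linear L" "inj L"
  obtains c :: real where "0 < c"
    "\<And>f. f \<in> borel_measurable borel \<Longrightarrow>
       (\<integral>\<^sup>+z. f (L z) \<partial>lborel) = ennreal c * (\<integral>\<^sup>+x. f x \<partial>lborel)"
proof -
  have cont: "continuous_on UNIV L" using assms(1) by (simp add: linear_continuous_on linear_conv_bounded_linear)
  then have [measurable]: "L \<in> borel_measurable borel" by (rule borel_measurable_continuous_onI)
  have [measurable]: "ball (y::'a) r \<in> sets borel" for y r by simp
  obtain K where K: "linear K" "\<And>x. K (L x) = x" "\<And>x. L (K x) = x"
    using linear_injective_isomorphism[OF assms] by blast
  have shift: "(\<integral>\<^sup>+z. f (z + v) \<partial>lborel) = (\<integral>\<^sup>+z. f z \<partial>lborel)"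
    if [measurable]: "f \<in> borel_measurable borel" for f :: "'a \<Rightarrow> ennreal" and v
    by (subst (2) lborel_distr_plus[of v, symmetric], subst nn_integral_distr) (auto simp: add.commute)
  let ?U = "ball (0::'a) 1"
  define V where "V = emeasure lborel ?U"
  have V: "V = ennreal (measure lborel ?U)" "0 < measure lborel ?U"
    unfolding V_def using content_ball_pos[of 1 "0::'a"] emeasure_bounded_finite[OF bounded_ball[of "0::'a" 1]] by (auto intro: emeasure_eq_ennreal_measure)
  define W where "W = (\<integral>\<^sup>+z. indicator ?U (L z) \<partial>lborel)"
  have "open (L -` ?U)" using cont by (intro open_vimage) auto
  moreover have "L -` ?U = K ` ?U" by (auto simp: K) (metis K(2) image_eqI mem_ball_0)
  ultimately have KU: "open (K ` ?U)" by simp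
  have "W = emeasure lborel (L -` ?U)"
  proof -
    have "indicator ?U (L z) = (indicator (L -` ?U) z :: ennreal)" for z by (simp add: indicator_def)
    then show ?thesis unfolding W_def using \<open>open (L -` ?U)\<close> by (simp only:) (simp add: nn_integral_indicator)
  qed
  also have "\<dots> = emeasure lborel (K ` ?U)" using \<open>L -` ?U = K ` ?U\<close> by simp
  finally have W: "W = emeasure lborel (K ` ?U)" .
  have "bounded (K ` ?U)" using K(1) by (simp add: bounded_linear_image linear_conv_bounded_linear)
  then have "W < \<infinity>" unfolding W by (rule emeasure_bounded_finite)
  moreover have "W \<noteq> 0"
  proof
    assume "W = 0"
    then have "K ` ?U \<in> null_sets lborel" using KU W by (auto simp: null_sets_def)
    then have "negligible (K ` ?U)" using negligible_iff_null_sets null_sets_completionI by blast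
    then show False using KU open_not_negligible by fastforce
  qed
  ultimately obtain w where w: "W = ennreal w" "0 < w"
    by (cases W) (auto simp: less_top[symmetric] zero_less_iff_neq_zero)
  have main: "W * (\<integral>\<^sup>+x. f x \<partial>lborel) = V * (\<integral>\<^sup>+z. f (L z) \<partial>lborel)"
    if [measurable]: "f \<in> borel_measurable borel" for f :: "'a \<Rightarrow> ennreal"
  proof -
    have "W * (\<integral>\<^sup>+x. f x \<partial>lborel) = (\<integral>\<^sup>+z. indicator ?U (L z) * (\<integral>\<^sup>+x. f x \<partial>lborel) \<partial>lborel)"
      unfolding W_def by (intro nn_integral_multc[symmetric]) measurable
    also have "\<dots> = (\<integral>\<^sup>+z. \<integral>\<^sup>+x. indicator ?U (L z) * f (x + L z) \<partial>lborel \<partial>lborel)"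
      by (simp add: nn_integral_cmult shift)
    also have "\<dots> = (\<integral>\<^sup>+x. \<integral>\<^sup>+z. indicator ?U (L z) * f (x + L z) \<partial>lborel \<partial>lborel)"
      by (rule lborel_pair.Fubini') measurable
    also have "\<dots> = (\<integral>\<^sup>+x. \<integral>\<^sup>+z. indicator ?U (L z - x) * f (L z) \<partial>lborel \<partial>lborel)"
    proof (rule nn_integral_cong)
      fix x
      have "L (z + K x) = x + L z" for z using K linear_add[OF assms(1)] by simp
      then show "(\<integral>\<^sup>+z. indicator ?U (L z) * f (x + L z) \<partial>lborel) = (\<integral>\<^sup>+z. indicator ?U (L z - x) * f (L z) \<partial>lborel)"
        using shift[of "\<lambda>z. indicator ?U (L z - x) * f (L z)" "K x"] by simp
    qed
    also have "\<dots> = (\<integral>\<^sup>+z. \<integral>\<^sup>+x. indicator ?U (L z - x) * f (L z) \<partial>lborel \<partial>lborel)"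
      by (rule lborel_pair.Fubini') measurable
    also have "\<dots> = (\<integral>\<^sup>+z. (\<integral>\<^sup>+x. indicator ?U (L z - x) \<partial>lborel) * f (L z) \<partial>lborel)"
      by (intro nn_integral_cong nn_integral_multc) measurable
    also have "(\<lambda>z. \<integral>\<^sup>+x. indicator ?U (L z - x) \<partial>lborel) = (\<lambda>z. V)"
    proof
      fix z
      have "(\<integral>\<^sup>+x. indicator ?U (L z - x) \<partial>lborel) = (\<integral>\<^sup>+x. indicator (ball (L z) 1) x \<partial>lborel)"
        by (intro nn_integral_cong) (simp add: indicator_def dist_norm norm_minus_commute)
      also have "\<dots> = (\<integral>\<^sup>+x. indicator (ball (L z) 1) (x + L z) \<partial>lborel)"
        by (rule shift[symmetric]) simp
      also have "\<dots> = (\<integral>\<^sup>+x. indicator ?U x \<partial>lborel)"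
        by (intro nn_integral_cong) (simp add: indicator_def dist_norm norm_minus_commute)
      finally show "(\<integral>\<^sup>+x. indicator ?U (L z - x) \<partial>lborel) = V" unfolding V_def by simp
    qed
    finally show ?thesis by (simp add: nn_integral_cmult)
  qed
  show thesis
  proof (rule that[of "w / measure lborel ?U"])
    show "0 < w / measure lborel ?U" using w V by simp
    fix f :: "'a \<Rightarrow> ennreal" assume "f \<in> borel_measurable borel"
    from main[OF this] have "ennreal (1 / measure lborel ?U) * (ennreal w * (\<integral>\<^sup>+x. f x \<partial>lborel)) =
        ennreal (1 / measure lborel ?U) * (ennreal (measure lborel ?U) * (\<integral>\<^sup>+z. f (L z) \<partial>lborel))"
      using V w by simp
    then show "(\<integral>\<^sup>+z. f (L z) \<partial>lborel) = ennreal (w / measure lborel ?U) * (\<integral>\<^sup>+x. f x \<partial>lborel)"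
      using V w by (simp add: mult.assoc[symmetric] ennreal_mult[symmetric])
  qed
qed

lemma integral_lborel_affine:
  fixes L :: "'a::euclidean_space \<Rightarrow> 'a"
  assumes "linear L" "inj L"
  obtains c :: real where "0 < c"
    "\<And>f :: 'a \<Rightarrow> real. f \<in> borel_measurable borel \<Longrightarrow>
       (LINT z|lborel. f (a + L z)) = c * (LINT x|lborel. f x)"
proof -
  obtain c where c: "0 < c" "\<And>f. f \<in> borel_measurable borel \<Longrightarrow>
       (\<integral>\<^sup>+z. f (L z) \<partial>lborel) = ennreal c * (\<integral>\<^sup>+x. f x \<partial>lborel)"
    using nn_integral_lborel_linear[OF assms] by blast
  have "continuous_on UNIV L" using assms(1) by (simp add: linear_continuous_on linear_conv_bounded_linear)
  then have [measurable]: "L \<in> borel_measurable borel" by (rule borel_measurable_continuous_onI)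
  have distr: "distr lborel borel L = density lborel (\<lambda>_. ennreal c)"
  proof (rule measure_eqI)
    fix A assume "A \<in> sets (distr lborel borel L)"
    then have [measurable]: "A \<in> sets borel" by simp
    have "emeasure (distr lborel borel L) A = (\<integral>\<^sup>+z. indicator A (L z) \<partial>lborel)"
      by (subst nn_integral_indicator[symmetric], simp, subst nn_integral_distr) auto
    also have "\<dots> = emeasure (density lborel (\<lambda>_. ennreal c)) A"
      by (simp add: c(2) emeasure_density_const)
    finally show "emeasure (distr lborel borel L) A = emeasure (density lborel (\<lambda>_. ennreal c)) A" .
  qed simp
  show thesis
  proof (rule that[OF c(1)])
    fix f :: "'a \<Rightarrow> real" assume [measurable]: "f \<in> borel_measurable borel"
    have "(LINT z|lborel. f (a + L z)) = (LINT x|distr lborel borel L. f (a + x))"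
      by (subst integral_distr) auto
    also have "\<dots> = c * (LINT x|lborel. f (a + x))"
      unfolding distr using c(1) by (subst integral_density) auto
    also have "(LINT x|lborel. f (a + x)) = (LINT x|lborel. f x)"
      by (subst (2) lborel_distr_plus[of a, symmetric], subst integral_distr) auto
    finally show "(LINT z|lborel. f (a + L z)) = c * (LINT x|lborel. f x)" .
  qed
qed

section \<open>Algebra of polynomial functions\<close>

definition monomial_fun :: "('n::finite \<Rightarrow> nat) \<Rightarrow> real^'n \<Rightarrow> real" where
  "monomial_fun \<alpha> x = (\<Prod>i\<in>UNIV. (x $ i) ^ \<alpha> i)"

lemma finite_multiindices: "finite {\<alpha>::'n::finite \<Rightarrow> nat. sum \<alpha> UNIV \<le> s}"
proof (rule finite_subset)
  show "{\<alpha>::'n \<Rightarrow> nat. sum \<alpha> UNIV \<le> s} \<subseteq> PiE UNIV (\<lambda>_. {..s})"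
  proof (clarsimp simp: PiE_UNIV_domain)
    fix \<alpha> :: "'n \<Rightarrow> nat" and i assume "sum \<alpha> UNIV \<le> s"
    moreover have "\<alpha> i \<le> sum \<alpha> UNIV" by (intro member_le_sum) auto
    ultimately show "\<alpha> i \<le> s" by simp
  qed
  show "finite (PiE (UNIV::'n set) (\<lambda>_. {..s}))" by (intro finite_PiE) auto
qed

lemma polysE:
  assumes "f \<in> polys s"
  obtains c where "f = (\<lambda>x. \<Sum>\<alpha> | sum \<alpha> UNIV \<le> s. c \<alpha> * of_real (monomial_fun \<alpha> x))"
  using assms unfolding polys_def monomial_fun_def by blast

lemma polys_add:
  assumes "f \<in> polys s" "g \<in> polys s" shows "(\<lambda>x. f x + g x) \<in> polys s"
proof -
  obtain c where "f = (\<lambda>x. \<Sum>\<alpha> | sum \<alpha> UNIV \<le> s. c \<alpha> * of_real (monomial_fun \<alpha> x))"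
    using polysE[OF assms(1)] .
  moreover obtain d where "g = (\<lambda>x. \<Sum>\<alpha> | sum \<alpha> UNIV \<le> s. d \<alpha> * of_real (monomial_fun \<alpha> x))"
    using polysE[OF assms(2)] .
  ultimately show ?thesis
    unfolding polys_def monomial_fun_def
    by (intro CollectI exI[of _ "\<lambda>\<alpha>. c \<alpha> + d \<alpha>"]) (simp add: distrib_right sum.distrib)
qed

lemma polys_zero: "(\<lambda>x. 0) \<in> polys s"
  unfolding polys_def by (intro CollectI exI[of _ "\<lambda>_. 0"]) simp

lemma polys_sum: "(\<And>i. i \<in> I \<Longrightarrow> f i \<in> polys s) \<Longrightarrow> (\<lambda>x. \<Sum>i\<in>I. f i x) \<in> polys s"
  by (induction I rule: infinite_finite_induct) (simp_all add: polys_zero polys_add)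

lemma polys_monomial:
  assumes "sum \<alpha> UNIV \<le> s" shows "(\<lambda>x. c * of_real (monomial_fun \<alpha> x)) \<in> polys s"
proof -
  have "c * of_real (monomial_fun \<alpha> x) =
      (\<Sum>\<beta> | sum \<beta> UNIV \<le> s. (if \<beta> = \<alpha> then c else 0) * of_real (monomial_fun \<beta> x))" for x
  proof -
    have "(\<Sum>\<beta> | sum \<beta> UNIV \<le> s. (if \<beta> = \<alpha> then c else 0) * of_real (monomial_fun \<beta> x)) =
        (\<Sum>\<beta> | sum \<beta> UNIV \<le> s. if \<beta> = \<alpha> then c * of_real (monomial_fun \<alpha> x) else 0)"
      by (intro sum.cong) auto
    then show ?thesis using assms by (simp add: sum.delta[OF finite_multiindices])
  qed
  then show ?thesis unfolding polys_def monomial_fun_def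
    by (intro CollectI exI[of _ "\<lambda>\<beta>. if \<beta> = \<alpha> then c else 0"] ext)
qed

lemma polys_cmult:
  assumes "f \<in> polys s" shows "(\<lambda>x. k * f x) \<in> polys s"
proof -
  obtain c where f: "f = (\<lambda>x. \<Sum>\<alpha> | sum \<alpha> UNIV \<le> s. c \<alpha> * of_real (monomial_fun \<alpha> x))"
    using polysE[OF assms(1)] .
  show ?thesis unfolding f sum_distrib_left mult.assoc[symmetric] by (intro polys_sum polys_monomial) auto
qed

lemma polys_diff: "f \<in> polys s \<Longrightarrow> g \<in> polys s \<Longrightarrow> (\<lambda>x. f x - g x) \<in> polys s"
  using polys_add[of f s "\<lambda>x. (-1) * g x"] polys_cmult[of g s "-1"] by simp

lemma polys_mono:
  assumes "f \<in> polys s" "s \<le> t" shows "f \<in> polys t"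
proof -
  obtain c where f: "f = (\<lambda>x. \<Sum>\<alpha> | sum \<alpha> UNIV \<le> s. c \<alpha> * of_real (monomial_fun \<alpha> x))"
    using polysE[OF assms(1)] .
  show ?thesis unfolding f using assms(2) by (intro polys_sum polys_monomial) auto
qed

lemma polys_mult:
  assumes "f \<in> polys s" "g \<in> polys t" shows "(\<lambda>x. f x * g x) \<in> polys (s + t)"
proof -
  obtain c where f: "f = (\<lambda>x. \<Sum>\<alpha> | sum \<alpha> UNIV \<le> s. c \<alpha> * of_real (monomial_fun \<alpha> x))"
    using polysE[OF assms(1)] .
  obtain d where g: "g = (\<lambda>x. \<Sum>\<alpha> | sum \<alpha> UNIV \<le> t. d \<alpha> * of_real (monomial_fun \<alpha> x))"
    using polysE[OF assms(2)] .
  have *: "f x * g x = (\<Sum>\<alpha> | sum \<alpha> UNIV \<le> s. \<Sum>\<beta> | sum \<beta> UNIV \<le> t.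
      (c \<alpha> * d \<beta>) * of_real (monomial_fun (\<lambda>i. \<alpha> i + \<beta> i) x))" for x
    unfolding f g sum_product
    by (intro sum.cong refl) (simp add: monomial_fun_def power_add prod.distrib mult_ac)
  show ?thesis unfolding * by (intro polys_sum polys_monomial) (auto simp: sum.distrib)
qed

lemma polys_const: "(\<lambda>x. c) \<in> polys s"
  using polys_monomial[of "\<lambda>_. 0" s c] by (simp add: monomial_fun_def)

lemma polys_coordinate: "(\<lambda>x::real^'n. x $ i) \<in> polys (Suc 0)"
proof -
  have "monomial_fun (\<lambda>j. of_bool (j = i)) x = x $ i" for x :: "real^'n"
  proof -
    have "monomial_fun (\<lambda>j. of_bool (j = i)) x = (\<Prod>j\<in>UNIV. if j = i then x $ j else 1)"
      unfolding monomial_fun_def by (intro prod.cong) auto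
    then show ?thesis by simp
  qed
  then show ?thesis using polys_monomial[of "\<lambda>j::'n. of_bool (j = i)" 1 "1::real"] by simp
qed

lemma polys_power: "f \<in> polys (Suc 0) \<Longrightarrow> (\<lambda>x. f x ^ k) \<in> polys k"
proof (induction k)
  case (Suc k)
  then show ?case using polys_mult[of f "Suc 0" "\<lambda>x. f x ^ k" k] by simp
qed (simp add: polys_const)

lemma polys_prod:
  "(\<And>i. i \<in> I \<Longrightarrow> f i \<in> polys (d i)) \<Longrightarrow> (\<lambda>x. \<Prod>i\<in>I. f i x) \<in> polys (sum d I)"
  by (induction I rule: infinite_finite_induct) (simp_all add: polys_const polys_mult)

lemma polys_affine_coordinate:
  fixes L :: "real^'n \<Rightarrow> real^'n"
  assumes "linear L" shows "(\<lambda>x. L (x - a) $ i) \<in> polys (Suc 0)"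
proof -
  have eq: "L (x - a) $ i = (\<Sum>j\<in>UNIV. matrix L $ i $ j * (x $ j - a $ j))" for x
  proof -
    have "L (x - a) = matrix L *v (x - a)" using assms by (simp add: linear_matrix_vector_mul_eq)
    then show ?thesis by (simp add: matrix_vector_mult_def)
  qed
  show ?thesis
    unfolding eq by (intro polys_sum polys_cmult polys_diff polys_coordinate polys_const)
qed

text \<open>Coordinates of an affine map are polynomials of degree one, so a monomial of degree \<open>d\<close> becomes a
  product of \<open>d\<close> of them. This invariance makes one basis on the unit ball serve all ellipsoids.\<close>

lemma polys_compose_affine:
  fixes L :: "real^'n \<Rightarrow> real^'n" and f :: "real^'n \<Rightarrow> real"
  assumes "linear L" "f \<in> polys s" shows "(\<lambda>x. f (L (x - a))) \<in> polys s"
proof -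
  obtain c where f: "f = (\<lambda>x. \<Sum>\<alpha> | sum \<alpha> UNIV \<le> s. c \<alpha> * of_real (monomial_fun \<alpha> x))"
    using polysE[OF assms(2)] .
  have "(\<lambda>x. monomial_fun \<alpha> (L (x - a))) \<in> polys (sum \<alpha> UNIV)" for \<alpha>
    unfolding monomial_fun_def by (intro polys_prod polys_power polys_affine_coordinate assms)
  then have "(\<lambda>x. monomial_fun \<alpha> (L (x - a))) \<in> polys s" if "sum \<alpha> UNIV \<le> s" for \<alpha>
    using polys_mono that by blast
  then show ?thesis unfolding f by (intro polys_sum polys_cmult) simp
qed

lemma continuous_on_polys:
  fixes f :: "real^'n \<Rightarrow> 'a::{real_normed_field,euclidean_space}"
  assumes "f \<in> polys s" shows "continuous_on S f"
proof -
  obtain c where f: "f = (\<lambda>x. \<Sum>\<alpha> | sum \<alpha> UNIV \<le> s. c \<alpha> * of_real (monomial_fun \<alpha> x))"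
    using polysE[OF assms] .
  show ?thesis unfolding f monomial_fun_def by (intro continuous_intros)
qed

lemma borel_measurable_polys:
  fixes f :: "real^'n \<Rightarrow> 'a::{real_normed_field,euclidean_space}"
  assumes "f \<in> polys s" shows "f \<in> borel_measurable lebesgue"
  using borel_measurable_continuous_onI[OF continuous_on_polys[OF assms]]
  by (intro measurable_completion) simp

lemma polys_of_real:
  assumes "f \<in> polys s"
  shows "(\<lambda>x. of_real (f x) :: 'a::{real_normed_field,euclidean_space}) \<in> polys s"
proof -
  obtain c where f: "f = (\<lambda>x. \<Sum>\<alpha> | sum \<alpha> UNIV \<le> s. c \<alpha> * of_real (monomial_fun \<alpha> x))"
    using polysE[OF assms] .
  show ?thesis unfolding f by (auto intro!: polys_sum polys_monomial)
qed

text \<open>Along the line through \<open>x\<^sub>0\<close> and \<open>y\<close> the function is a polynomial of one variable with infinitely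
  many zeros near \<open>x\<^sub>0\<close>; so it vanishes at \<open>y\<close> too.\<close>

lemma polys_eq_zero:
  fixes f :: "real^'n \<Rightarrow> real"
  assumes f: "f \<in> polys s" and "open U" "x\<^sub>0 \<in> U" and zero: "\<And>x. x \<in> U \<Longrightarrow> f x = 0"
  shows "f y = 0"
proof -
  obtain c where c: "f = (\<lambda>x. \<Sum>\<alpha> | sum \<alpha> UNIV \<le> s. c \<alpha> * of_real (monomial_fun \<alpha> x))"
    using polysE[OF f] .
  define q where "q = (\<Sum>\<alpha> | sum \<alpha> UNIV \<le> s.
      [:c \<alpha>:] * (\<Prod>i\<in>UNIV. [:x\<^sub>0 $ i, (y - x\<^sub>0) $ i:] ^ \<alpha> i))"
  have q: "poly q t = f (x\<^sub>0 + t *\<^sub>R (y - x\<^sub>0))" for t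
    unfolding q_def c monomial_fun_def by (simp add: poly_sum poly_prod)
  have "continuous_on UNIV (\<lambda>t. x\<^sub>0 + t *\<^sub>R (y - x\<^sub>0))" by (intro continuous_intros)
  then have "open ((\<lambda>t. x\<^sub>0 + t *\<^sub>R (y - x\<^sub>0)) -` U)" using assms(2) by (rule open_vimage[rotated])
  moreover have "0 \<in> (\<lambda>t. x\<^sub>0 + t *\<^sub>R (y - x\<^sub>0)) -` U" using assms(3) by simp
  ultimately have "infinite ((\<lambda>t. x\<^sub>0 + t *\<^sub>R (y - x\<^sub>0)) -` U)"
    by (metis empty_iff finite_imp_not_open)
  then have "infinite {t. poly q t = 0}"
    by (rule contrapos_nn) (auto elim!: finite_subset[rotated] simp: q zero)
  then have "q = 0" using poly_roots_finite by blast
  then show ?thesis using q[of 1] by simp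
qed

section \<open>Averages over ellipsoids\<close>

text \<open>Every dilated ball is of this form. Working with the affine images of one fixed set is what makes the
  constants below independent of the ball.\<close>

definition ellipsoid :: "(real^'n) set \<Rightarrow> bool" where
  "ellipsoid B \<longleftrightarrow> (\<exists>a (L :: real^'n \<Rightarrow> real^'n). linear L \<and> inj L \<and> B = (\<lambda>x. a + L x) ` ball 0 1)"

lemma ellipsoid_unit_ball: "ellipsoid (ball 0 1)"
  unfolding ellipsoid_def by (intro exI[of _ 0] exI[of _ "\<lambda>x. x"]) (simp add: linear_ident)

lemma ellipsoid_image:
  fixes B :: "(real^'n) set" and K :: "real^'n \<Rightarrow> real^'n"
  assumes "ellipsoid B" "linear K" "inj K" shows "ellipsoid ((\<lambda>x. c + K x) ` B)"
proof -
  obtain a and L :: "real^'n \<Rightarrow> real^'n" where L: "linear L" "inj L" and B: "B = (\<lambda>x. a + L x) ` ball 0 1"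
    using assms(1) unfolding ellipsoid_def by blast
  have "(\<lambda>x. c + K x) ` B = (\<lambda>x. (c + K a) + (K \<circ> L) x) ` ball 0 1"
    unfolding B image_image by (simp add: linear_add[OF assms(2)] add.assoc)
  moreover have "linear (K \<circ> L)" "inj (K \<circ> L)"
    using L assms by (auto intro: linear_compose inj_compose)
  ultimately show ?thesis unfolding ellipsoid_def by blast
qed

lemma
  fixes B :: "(real^'n) set"
  assumes "ellipsoid B"
  shows open_ellipsoid: "open B" and bounded_ellipsoid: "bounded B"
    and ellipsoid_nonempty: "B \<noteq> {}"
proof -
  obtain a and L :: "real^'n \<Rightarrow> real^'n" where L: "linear L" "inj L" and B: "B = (\<lambda>x. a + L x) ` ball 0 1"
    using assms unfolding ellipsoid_def by blast
  have *: "B = (+) a ` L ` ball 0 1" unfolding B by (simp add: image_image)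
  show "open B" unfolding *
    using L by (intro open_translation) (simp add: open_bijective_linear_image_eq linear_injective_imp_surjective bij_def)
  show "bounded B" unfolding *
    using L by (intro bounded_translation bounded_linear_image) (auto simp: linear_conv_bounded_linear)
  show "B \<noteq> {}" unfolding B by simp
qed

lemma
  fixes B :: "(real^'n) set"
  assumes "ellipsoid B"
  shows lmeasurable_ellipsoid: "B \<in> lmeasurable" and measure_ellipsoid_pos: "0 < measure lebesgue B"
proof -
  show m: "B \<in> lmeasurable"
    using open_ellipsoid[OF assms] bounded_ellipsoid[OF assms] by (simp add: lmeasurable_open)
  have "\<not> negligible B" using assms open_not_negligible open_ellipsoid ellipsoid_nonempty by blast
  then show "0 < measure lebesgue B" using m negligible_iff_measure[of B]
    by (simp add: order_less_le)
qed

lemma ellipsoid_sets [simp]: "ellipsoid B \<Longrightarrow> B \<in> sets lebesgue"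
  using lmeasurable_ellipsoid by blast

lemma set_integrable_const_ellipsoid:
  fixes c :: "'b::{banach,second_countable_topology}"
  assumes "ellipsoid B" shows "set_integrable lebesgue B (\<lambda>x. c)"
  using lmeasurable_ellipsoid[OF assms] unfolding set_integrable_def fmeasurable_def
  by (auto intro!: integrable_scaleR_left)

lemma polys_bounded:
  fixes h :: "real^'n \<Rightarrow> 'a::{real_normed_field,euclidean_space}"
  assumes "bounded B" "h \<in> polys s"
  obtains M where "0 \<le> M" "\<And>x. x \<in> B \<Longrightarrow> norm (h x) \<le> M"
proof -
  have "compact (h ` closure B)"
    using assms by (intro compact_continuous_image continuous_on_polys) auto
  then have "bounded (h ` closure B)" by (rule compact_imp_bounded)
  then obtain M where "\<forall>y\<in>h ` closure B. norm y \<le> M" unfolding bounded_iff by blast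
  then have "norm (h x) \<le> max 0 M" if "x \<in> B" for x
    using that closure_subset[of B] by (auto simp: subset_eq le_max_iff_disj)
  then show ?thesis by (intro that[of "max 0 M"]) simp_all
qed

lemma set_integrable_mult_polys:
  fixes g h :: "real^'n \<Rightarrow> 'a::{real_normed_field,euclidean_space}"
  assumes B: "ellipsoid B" and g: "set_integrable lebesgue B g" and h: "h \<in> polys s"
  shows "set_integrable lebesgue B (\<lambda>x. g x * h x)"
proof -
  obtain M where M: "0 \<le> M" "\<And>x. x \<in> B \<Longrightarrow> norm (h x) \<le> M"
    using polys_bounded[OF bounded_ellipsoid[OF B] h] by blast
  have [measurable]: "h \<in> borel_measurable lebesgue" using h by (rule borel_measurable_polys)
  have gm: "(\<lambda>x. indicat_real B x *\<^sub>R g x) \<in> borel_measurable lebesgue"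
    using g unfolding set_integrable_def by simp
  show ?thesis
  proof (rule set_integrable_bound)
    show "set_integrable lebesgue B (\<lambda>x. M *\<^sub>R g x)" using g by simp
    have "(\<lambda>x. (indicat_real B x *\<^sub>R g x) * h x) \<in> borel_measurable lebesgue"
      using gm by measurable
    then show "set_borel_measurable lebesgue B (\<lambda>x. g x * h x)"
      unfolding set_borel_measurable_def by simp
    show "AE x in lebesgue. x \<in> B \<longrightarrow> norm (g x * h x) \<le> norm (M *\<^sub>R g x)"
    proof (intro AE_I2 impI)
      fix x assume "x \<in> B"
      then have "norm (g x) * norm (h x) \<le> norm (g x) * M" using M by (intro mult_left_mono) auto
      then show "norm (g x * h x) \<le> norm (M *\<^sub>R g x)" using M(1) by (simp add: norm_mult mult.commute)
    qed
  qed
qed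

lemma set_integrable_polys:
  fixes h :: "real^'n \<Rightarrow> 'a::{real_normed_field,euclidean_space}"
  assumes B: "ellipsoid B" and h: "h \<in> polys s"
  shows "set_integrable lebesgue B h"
proof -
  have "set_integrable lebesgue B (\<lambda>x. 1::'a)" by (rule set_integrable_const_ellipsoid[OF B])
  from set_integrable_mult_polys[OF B this h] show ?thesis by simp
qed

definition avg :: "(real^'n) set \<Rightarrow> (real^'n \<Rightarrow> 'a::euclidean_space) \<Rightarrow> 'a" where
  "avg B f = (LINT x:B|lebesgue. f x) /\<^sub>R measure lebesgue B"

lemma avg_eq_0_iff: "ellipsoid B \<Longrightarrow> avg B f = 0 \<longleftrightarrow> (LINT x:B|lebesgue. f x) = 0"
  using measure_ellipsoid_pos[of B] by (simp add: avg_def)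

lemma avg_add:
  "set_integrable lebesgue B f \<Longrightarrow> set_integrable lebesgue B g \<Longrightarrow> avg B (\<lambda>x. f x + g x) = avg B f + avg B g"
  by (simp add: avg_def set_integral_add scaleR_add_right)

lemma avg_diff:
  "set_integrable lebesgue B f \<Longrightarrow> set_integrable lebesgue B g \<Longrightarrow> avg B (\<lambda>x. f x - g x) = avg B f - avg B g"
  by (simp add: avg_def set_integral_diff scaleR_diff_right)

lemma avg_cmult:
  fixes f :: "real^'n \<Rightarrow> 'a::{real_normed_field,euclidean_space}"
  shows "avg B (\<lambda>x. c * f x) = c * avg B f"
  by (simp add: avg_def)

lemma avg_sum:
  assumes "\<And>i. i \<in> I \<Longrightarrow> set_integrable lebesgue B (f i)"
  shows "avg B (\<lambda>x. \<Sum>i\<in>I. f i x) = (\<Sum>i\<in>I. avg B (f i))"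
  using assms unfolding avg_def set_lebesgue_integral_def set_integrable_def
  by (simp add: scaleR_sum_right)

lemma avg_of_real:
  assumes "ellipsoid B" "f \<in> polys s"
  shows "avg B (\<lambda>x. of_real (f x) :: 'a::{real_normed_field,euclidean_space}) = of_real (avg B f)"
proof -
  have "(LINT x:B|lebesgue. of_real (f x) :: 'a) = of_real (LINT x:B|lebesgue. f x)"
    using integral_bounded_linear[OF bounded_linear_of_real set_integrable_polys[OF assms, unfolded set_integrable_def]]
    by (simp add: set_lebesgue_integral_def scaleR_conv_of_real)
  then show ?thesis by (simp add: avg_def scaleR_conv_of_real)
qed

lemma avg_mono:
  fixes f g :: "real^'n \<Rightarrow> real"
  assumes "set_integrable lebesgue B g" "\<And>x. x \<in> B \<Longrightarrow> f x \<le> g x" "\<And>x. x \<in> B \<Longrightarrow> 0 \<le> g x"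
  shows "avg B f \<le> avg B g"
proof -
  have "(LINT x:B|lebesgue. f x) \<le> (LINT x:B|lebesgue. g x)"
    using assms unfolding set_lebesgue_integral_def set_integrable_def
    by (intro integral_mono') (auto simp: indicator_def)
  then show ?thesis unfolding avg_def by (simp add: mult_left_mono)
qed

lemma avg_nonneg:
  fixes f :: "real^'n \<Rightarrow> real"
  assumes "\<And>x. x \<in> B \<Longrightarrow> 0 \<le> f x" shows "0 \<le> avg B f"
  using assms unfolding avg_def set_lebesgue_integral_def
  by (auto intro!: mult_nonneg_nonneg Bochner_Integration.integral_nonneg simp: indicator_def)

lemma norm_avg_le:
  assumes "set_integrable lebesgue B f" "set_integrable lebesgue B g" "\<And>x. x \<in> B \<Longrightarrow> norm (f x) \<le> g x"
  shows "norm (avg B f) \<le> avg B g"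
proof -
  have "norm (LINT x:B|lebesgue. f x) \<le> (LINT x:B|lebesgue. g x)"
    using assms unfolding set_lebesgue_integral_def set_integrable_def
    by (intro Bochner_Integration.integral_norm_bound_integral) (auto simp: indicator_def)
  then show ?thesis by (simp add: avg_def mult_left_mono)
qed

lemma avg_const: "ellipsoid B \<Longrightarrow> avg B (\<lambda>x. c :: real) = c"
  using measure_ellipsoid_pos[of B] by (simp add: avg_def set_lebesgue_integral_def)

text \<open>Averages are affine invariant: the Jacobian factor cancels against the one in the volume.\<close>

lemma avg_affine:
  fixes L :: "real^'n \<Rightarrow> real^'n" and h :: "real^'n \<Rightarrow> real"
  assumes L: "linear L" "inj L" and K: "linear K" "\<And>x. K (L x) = x"
    and h: "h \<in> polys s"
  shows "avg ((\<lambda>x. a + L x) ` ball 0 1) (\<lambda>y. h (K (y - a))) = avg (ball 0 1) h"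
proof -
  let ?U = "ball 0 1 :: (real^'n) set" and ?B = "(\<lambda>x. a + L x) ` ball 0 1"
  obtain c where c: "0 < c" "\<And>f :: real^'n \<Rightarrow> real. f \<in> borel_measurable borel \<Longrightarrow>
       (LINT z|lborel. f (a + L z)) = c * (LINT x|lborel. f x)"
    using integral_lborel_affine[OF L, of a] by blast
  have B: "ellipsoid ?B" using L unfolding ellipsoid_def by blast
  have U: "ellipsoid ?U" by (rule ellipsoid_unit_ball)
  have [measurable]: "?B \<in> sets borel" "?U \<in> sets borel"
    using open_ellipsoid[OF B] open_ellipsoid[OF U] by simp_all
  have ind: "indicat_real ?B (a + L z) = indicat_real ?U z" for z
  proof -
    have "a + L z \<in> ?B \<longleftrightarrow> z \<in> ?U" 
      using inj_image_mem_iff[of "\<lambda>x. a + L x" z ?U] L(2) by (simp add: inj_def)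
    then show ?thesis by (simp add: indicator_def)
  qed
  have set_int: "(LINT x:?U|lebesgue. g x) = c * (LINT y:?B|lebesgue. g (K (y - a)))"
    if g: "g \<in> polys s" for g :: "real^'n \<Rightarrow> real"
  proof -
    have [measurable]: "g \<in> borel_measurable borel"
      by (rule borel_measurable_continuous_onI[OF continuous_on_polys[OF g]])
    have [measurable]: "(\<lambda>y. g (K (y - a))) \<in> borel_measurable borel"
      by (rule borel_measurable_continuous_onI[OF continuous_on_polys[OF polys_compose_affine[OF K(1) g]]])
    have "(LINT x:?U|lebesgue. g x) = (LINT z|lborel. indicat_real ?U z * g z)"
      unfolding set_lebesgue_integral_def by (subst integral_completion) auto
    also have "\<dots> = (LINT z|lborel. indicat_real ?B (a + L z) * g (K (a + L z - a)))"
      by (simp add: ind K)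
    also have "\<dots> = c * (LINT y|lborel. indicat_real ?B y * g (K (y - a)))"
      by (rule c(2)) measurable
    also have "(LINT y|lborel. indicat_real ?B y * g (K (y - a))) = (LINT y:?B|lebesgue. g (K (y - a)))"
      unfolding set_lebesgue_integral_def by (subst integral_completion) auto
    finally show ?thesis .
  qed
  have "measure lebesgue S = (LINT x:S|lebesgue. 1)" if "ellipsoid S" for S :: "(real^'n) set"
    using that by (simp add: set_lebesgue_integral_def)
  with set_int[OF polys_const, of 1] B U have "measure lebesgue ?U = c * measure lebesgue ?B"
    by metis
  then show ?thesis unfolding avg_def set_int[OF h] using c(1) by simp
qed

lemma polys_eq_zero_if_avg_square:
  fixes h :: "real^'n \<Rightarrow> real"
  assumes B: "ellipsoid B" and h: "h \<in> polys s" and zero: "avg B (\<lambda>x. h x * h x) = 0"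
  shows "h y = 0"
proof -
  have "set_integrable lebesgue B (\<lambda>x. h x * h x)"
    using B h by (intro set_integrable_mult_polys set_integrable_polys)
  then have "AE x in lebesgue. indicat_real B x *\<^sub>R (h x * h x) = 0"
    using zero unfolding avg_eq_0_iff[OF B] set_integrable_def set_lebesgue_integral_def
    by (subst (asm) integral_nonneg_eq_0_iff_AE) auto
  then have ae: "AE x in lebesgue. \<not> (x \<in> B \<and> h x \<noteq> 0)"
    by eventually_elim (auto simp: indicator_def)
  have op: "open {x \<in> B. h x \<noteq> 0}"
  proof -
    have "{x \<in> B. h x \<noteq> 0} = B \<inter> h -` (- {0})" by auto
    then show ?thesis using open_ellipsoid[OF B] continuous_on_polys[OF h, of UNIV]
      by (auto intro!: open_Int open_vimage)
  qed
  then have "{x \<in> B. h x \<noteq> 0} \<in> sets lebesgue" by simp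
  with ae have "negligible {x \<in> B. h x \<noteq> 0}"
    by (simp add: negligible_iff_null_sets AE_iff_null)
  with op have "{x \<in> B. h x \<noteq> 0} = {}" using open_not_negligible by blast
  then have zero: "\<And>x. x \<in> B \<Longrightarrow> h x = 0" by auto
  obtain x where "x \<in> B" using ellipsoid_nonempty[OF B] by auto
  from polys_eq_zero[OF h open_ellipsoid[OF B] this zero] show ?thesis .
qed

section \<open>Orthonormal polynomials\<close>

text \<open>The members are real even when the functions to be expanded are not: monomials are real, so one real
  family spans the polynomials over every scalar type, and its Fourier coefficients are given by the pairing
  \<open>\<integral>gh\<close>, which has no conjugate.\<close>

definition orthonormal_polys :: "nat \<Rightarrow> (real^'n) set \<Rightarrow> nat \<Rightarrow> (nat \<Rightarrow> real^'n \<Rightarrow> real) \<Rightarrow> bool" where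
  "orthonormal_polys s B N e \<longleftrightarrow> (\<forall>i<N. e i \<in> polys s) \<and>
     (\<forall>i<N. \<forall>j<N. avg B (\<lambda>x. e i x * e j x) = of_bool (i = j))"

text \<open>Subtracting a combination of the \<open>e i\<close> lowers the \<open>j\<close>-th Fourier coefficient of \<open>g\<close> by the \<open>j\<close>-th
  coefficient of the combination. This single identity gives the Gram-Schmidt step, the orthogonality of the
  residual of the Fourier sum and the uniqueness of the projection.\<close>

lemma avg_expansion_residual:
  fixes g :: "real^'n \<Rightarrow> 'a::{real_normed_field,euclidean_space}"
  assumes B: "ellipsoid B" and e: "orthonormal_polys s B N e" and g: "set_integrable lebesgue B g"
    and j: "j < N"
  shows "avg B (\<lambda>x. (g x - (\<Sum>i<N. c i * of_real (e i x))) * of_real (e j x))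
       = avg B (\<lambda>x. g x * of_real (e j x)) - c j"
proof -
  have ep: "\<And>i. i < N \<Longrightarrow> e i \<in> polys s" and orth: "\<And>i. i < N \<Longrightarrow> avg B (\<lambda>x. e i x * e j x) = of_bool (i = j)"
    using e j unfolding orthonormal_polys_def by auto
  have prod: "(\<lambda>x. e i x * e j x) \<in> polys (s + s)" if "i < N" for i
    using polys_mult ep that j by blast
  have cprod: "(\<lambda>x. c i * of_real (e i x * e j x)) \<in> polys (s + s)" if "i < N" for i
    using polys_cmult[OF polys_of_real[OF prod[OF that]]] by simp
  have "avg B (\<lambda>x. (g x - (\<Sum>i<N. c i * of_real (e i x))) * of_real (e j x))
      = avg B (\<lambda>x. g x * of_real (e j x) - (\<Sum>i<N. c i * of_real (e i x * e j x)))"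
    by (simp add: left_diff_distrib sum_distrib_right mult.assoc)
  also have "\<dots> = avg B (\<lambda>x. g x * of_real (e j x)) - avg B (\<lambda>x. \<Sum>i<N. c i * of_real (e i x * e j x))"
  proof (rule avg_diff)
    show "set_integrable lebesgue B (\<lambda>x. g x * of_real (e j x))"
      by (rule set_integrable_mult_polys[OF B g polys_of_real[OF ep[OF j]]])
    show "set_integrable lebesgue B (\<lambda>x. \<Sum>i<N. c i * of_real (e i x * e j x))"
      by (rule set_integrable_polys[OF B polys_sum[OF cprod]]) simp
  qed
  also have "avg B (\<lambda>x. \<Sum>i<N. c i * of_real (e i x * e j x)) = (\<Sum>i<N. c i * of_bool (i = j))"
  proof -
    have "avg B (\<lambda>x. c i * of_real (e i x * e j x)) = c i * of_bool (i = j)" if "i < N" for i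
      unfolding avg_cmult avg_of_real[OF B prod[OF that]] orth[OF that] by simp
    then show ?thesis using avg_sum[OF set_integrable_polys[OF B cprod], of "{..<N}" "\<lambda>i. i"] by simp
  qed
  also have "\<dots> = (\<Sum>i<N. if i = j then c j else 0)" by (intro sum.cong) auto
  also have "\<dots> = c j" using j by simp
  finally show ?thesis .
qed

text \<open>Each function of \<open>F\<close> contributes its normalised residual, or nothing: if the residual has square
  average zero, the function is already in the span, since a polynomial vanishing almost everywhere on an
  ellipsoid is zero.\<close>

lemma Gram_Schmidt_polys:
  fixes F :: "(real^'n \<Rightarrow> real) set"
  assumes B: "ellipsoid B" and "finite F" "F \<subseteq> polys s"
  shows "\<exists>N e. orthonormal_polys s B N e \<and> (\<forall>f\<in>F. \<exists>c. f = (\<lambda>x. \<Sum>i<N. c i * e i x))"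
  using assms(2,3)
proof (induction F)
  case empty
  show ?case by (intro exI[of _ 0]) (simp add: orthonormal_polys_def)
next
  case (insert f F)
  then obtain N e where e: "orthonormal_polys s B N e"
    and F: "\<And>h. h \<in> F \<Longrightarrow> \<exists>c. h = (\<lambda>x. \<Sum>i<N. c i * e i x)" by blast
  have ep: "\<And>i. i < N \<Longrightarrow> e i \<in> polys s" and f: "f \<in> polys s"
    using e insert.prems unfolding orthonormal_polys_def by auto
  define c where "c i = avg B (\<lambda>x. f x * e i x)" for i
  define r where "r x = f x - (\<Sum>i<N. c i * e i x)" for x
  have r: "r \<in> polys s" unfolding r_def by (intro polys_diff polys_sum polys_cmult f ep) simp
  have re: "avg B (\<lambda>x. r x * e j x) = 0" if "j < N" for j
    using avg_expansion_residual[OF B e set_integrable_polys[OF B f] that, of c]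
    by (simp add: r_def c_def)
  have fr: "f x = (\<Sum>i<N. c i * e i x) + r x" for x by (simp add: r_def)
  define v where "v = avg B (\<lambda>x. r x * r x)"
  show ?case
  proof (cases "v = 0")
    case True
    then have "r x = 0" for x using polys_eq_zero_if_avg_square[OF B r] unfolding v_def by blast
    then have "f = (\<lambda>x. \<Sum>i<N. c i * e i x)" by (simp add: fr fun_eq_iff)
    then show ?thesis using e F by (intro exI[of _ N] exI[of _ e]) blast
  next
    case False
    have "0 \<le> v" unfolding v_def avg_def set_lebesgue_integral_def
      by (auto intro!: mult_nonneg_nonneg Bochner_Integration.integral_nonneg)
    with False have v: "0 < v" by simp
    define e' where "e' = e(N := (\<lambda>x. (1 / sqrt v) * r x))"
    have e'_less: "e' i = e i" if "i < N" for i using that by (simp add: e'_def)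
    have e'_N: "e' N = (\<lambda>x. (1 / sqrt v) * r x)" by (simp add: e'_def)
    have "orthonormal_polys s B (Suc N) e'"
      unfolding orthonormal_polys_def
    proof (intro conjI allI impI)
      fix i assume "i < Suc N"
      then show "e' i \<in> polys s"
        using ep polys_cmult[OF r, of "1 / sqrt v"] by (cases "i = N") (simp_all add: e'_less e'_N)
    next
      fix i j assume ij: "i < Suc N" "j < Suc N"
      have NN: "avg B (\<lambda>x. e' N x * e' N x) = 1"
      proof -
        have "avg B (\<lambda>x. e' N x * e' N x) = avg B (\<lambda>x. (1 / v) * (r x * r x))"
          unfolding e'_N using v by (simp add: field_simps)
        then show ?thesis using v unfolding avg_cmult v_def[symmetric] by simp
      qed
      have Nj: "avg B (\<lambda>x. e' N x * e' k x) = 0" if "k < N" for k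
      proof -
        have "avg B (\<lambda>x. e' N x * e' k x) = avg B (\<lambda>x. (1 / sqrt v) * (r x * e k x))"
          unfolding e'_N e'_less[OF that] by (simp add: mult.assoc)
        then show ?thesis unfolding avg_cmult re[OF that] by simp
      qed
      consider "i < N" "j < N" | "i = N" "j = N" | "i = N" "j < N" | "i < N" "j = N" using ij by linarith
      then show "avg B (\<lambda>x. e' i x * e' j x) = of_bool (i = j)"
      proof cases
        case 1 then show ?thesis using e by (simp add: e'_less orthonormal_polys_def)
      next
        case 2 then show ?thesis using NN by simp
      next
        case 3 then show ?thesis using Nj by simp
      next
        case 4 then show ?thesis using Nj[of i] by (simp add: mult.commute)
      qed
    qed
    moreover have "\<exists>d. h = (\<lambda>x. \<Sum>i<Suc N. d i * e' i x)" if h: "h \<in> insert f F" for h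
    proof (cases "h = f")
      case True
      have "h = (\<lambda>x. \<Sum>i<Suc N. (c(N := sqrt v)) i * e' i x)"
        unfolding True using v by (simp add: fun_eq_iff fr e'_less e'_N)
      then show ?thesis by blast
    next
      case False
      then obtain d where "h = (\<lambda>x. \<Sum>i<N. d i * e i x)" using F h by blast
      then have "h = (\<lambda>x. \<Sum>i<Suc N. (d(N := 0)) i * e' i x)" by (simp add: fun_eq_iff e'_less)
      then show ?thesis by blast
    qed
    ultimately show ?thesis by blast
  qed
qed

definition orthonormal_basis :: "nat \<Rightarrow> (real^'n) set \<Rightarrow> nat \<Rightarrow> (nat \<Rightarrow> real^'n \<Rightarrow> real) \<Rightarrow> bool" where
  "orthonormal_basis s B N e \<longleftrightarrow> orthonormal_polys s B N e \<and>
     (\<forall>h\<in>polys s. \<exists>c. h = (\<lambda>x. \<Sum>i<N. c i * e i x))"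

lemma orthonormal_basis_exists:
  assumes B: "ellipsoid B"
  obtains N e where "orthonormal_basis s B N e"
proof -
  let ?F = "monomial_fun ` {\<alpha>. sum \<alpha> UNIV \<le> s} :: (real^'a \<Rightarrow> real) set"
  have "?F \<subseteq> polys s" using polys_monomial[of _ s "1::real"] by auto
  then obtain N e where e: "orthonormal_polys s B N e" "\<forall>f\<in>?F. \<exists>c. f = (\<lambda>x. \<Sum>i<N. c i * e i x)"
    using Gram_Schmidt_polys[OF B, of ?F s] finite_multiindices by blast
  then have "\<forall>\<alpha>\<in>{\<alpha>. sum \<alpha> UNIV \<le> s}. \<exists>c. monomial_fun \<alpha> = (\<lambda>x. \<Sum>i<N. c i * e i x)" by blast
  from bchoice[OF this] obtain c
    where c: "monomial_fun \<alpha> = (\<lambda>x. \<Sum>i<N. c \<alpha> i * e i x)" if "sum \<alpha> UNIV \<le> s" for \<alpha>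
    by blast
  have "\<exists>d. h = (\<lambda>x. \<Sum>i<N. d i * e i x)" if hp: "h \<in> polys s" for h
  proof -
    obtain k where h: "h = (\<lambda>x. \<Sum>\<alpha> | sum \<alpha> UNIV \<le> s. k \<alpha> * of_real (monomial_fun \<alpha> x))"
      using polysE[OF hp] .
    have "h x = (\<Sum>i<N. (\<Sum>\<alpha> | sum \<alpha> UNIV \<le> s. k \<alpha> * c \<alpha> i) * e i x)" for x
    proof -
      have "h x = (\<Sum>\<alpha> | sum \<alpha> UNIV \<le> s. \<Sum>i<N. k \<alpha> * c \<alpha> i * e i x)"
        unfolding h by (intro sum.cong refl) (simp add: c sum_distrib_left mult.assoc)
      also have "\<dots> = (\<Sum>i<N. \<Sum>\<alpha> | sum \<alpha> UNIV \<le> s. k \<alpha> * c \<alpha> i * e i x)"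
        by (rule sum.swap)
      finally show ?thesis by (simp only: sum_distrib_right)
    qed
    then have "h = (\<lambda>x. \<Sum>i<N. (\<Sum>\<alpha> | sum \<alpha> UNIV \<le> s. k \<alpha> * c \<alpha> i) * e i x)"
      by (rule ext)
    then show ?thesis by (rule exI[where x = "\<lambda>i. \<Sum>\<alpha> | sum \<alpha> UNIV \<le> s. k \<alpha> * c \<alpha> i"])
  qed
  with e show ?thesis by (intro that[of N e]) (simp add: orthonormal_basis_def)
qed

text \<open>Choose a basis on the unit ball and pull it back by the affine map that sends a given ellipsoid to the
  ball. Orthonormality is kept because averages are affine invariant, spanning because the degree is, and the
  supremum norm does not change at all.\<close>

lemma uniformly_bounded_orthonormal_bases:
  obtains N M where "0 \<le> M"
    "\<And>B :: (real^'n) set. ellipsoid B \<Longrightarrow>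
       \<exists>e. orthonormal_basis s B N e \<and> (\<forall>i<N. \<forall>x\<in>B. \<bar>e i x\<bar> \<le> M)"
proof -
  let ?U = "ball 0 1 :: (real^'n) set"
  obtain N e where e: "orthonormal_basis s ?U N e"
    using orthonormal_basis_exists[OF ellipsoid_unit_ball] .
  then have on: "orthonormal_polys s ?U N e" and sp: "\<forall>h\<in>polys s. \<exists>c. h = (\<lambda>x. \<Sum>i<N. c i * e i x)"
    unfolding orthonormal_basis_def by (rule conjunct1, rule conjunct2)
  note span = bspec[OF sp]
  from on have ep: "\<And>i. i < N \<Longrightarrow> e i \<in> polys s"
    and orth: "\<And>i j. i < N \<Longrightarrow> j < N \<Longrightarrow> avg ?U (\<lambda>x. e i x * e j x) = of_bool (i = j)"
    unfolding orthonormal_polys_def by simp_all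
  have "\<exists>M\<ge>0. \<forall>x\<in>?U. \<bar>e i x\<bar> \<le> M" if i: "i < N" for i
  proof -
    obtain M where M: "0 \<le> M" "\<And>x. x \<in> ?U \<Longrightarrow> norm (e i x) \<le> M"
      using polys_bounded[OF bounded_ball[of 0 1] ep[OF i]] by blast
    have "\<forall>x\<in>?U. \<bar>e i x\<bar> \<le> M" using M(2) unfolding real_norm_def by (rule ballI)
    with M(1) show ?thesis by (intro exI[of _ M] conjI)
  qed
  then have "\<forall>i\<in>{..<N}. \<exists>M. 0 \<le> M \<and> (\<forall>x\<in>?U. \<bar>e i x\<bar> \<le> M)" by simp
  from bchoice[OF this] obtain m where "\<forall>i\<in>{..<N}. 0 \<le> m i \<and> (\<forall>x\<in>?U. \<bar>e i x\<bar> \<le> m i)" ..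
  then have m: "\<And>i. i < N \<Longrightarrow> 0 \<le> m i" "\<And>i x. i < N \<Longrightarrow> x \<in> ?U \<Longrightarrow> \<bar>e i x\<bar> \<le> m i"
    by auto
  define M where "M = (\<Sum>i<N. m i)"
  have mM: "m i \<le> M" if "i < N" for i unfolding M_def using that m by (intro member_le_sum) auto
  show thesis
  proof (rule that[of M])
    show "0 \<le> M" unfolding M_def using m by (intro sum_nonneg) auto
    fix B :: "(real^'n) set" assume "ellipsoid B"
    then obtain a and L :: "real^'n \<Rightarrow> real^'n" where L: "linear L" "inj L" and B: "B = (\<lambda>x. a + L x) ` ball 0 1"
      unfolding ellipsoid_def by blast
    obtain K where K: "linear K" "\<And>x. K (L x) = x" "\<And>x. L (K x) = x"
      using linear_injective_isomorphism[OF L] by blast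
    define e' where "e' i x = e i (K (x - a))" for i x
    have "e' i \<in> polys s" if "i < N" for i
      unfolding e'_def using ep[OF that] K(1) by (rule polys_compose_affine[rotated])
    moreover have "avg B (\<lambda>x. e' i x * e' j x) = of_bool (i = j)" if "i < N" "j < N" for i j
      using avg_affine[OF L K(1,2) polys_mult[OF ep ep, OF that], of a] orth[OF that]
      unfolding B e'_def by simp
    moreover have "\<exists>c. h = (\<lambda>x. \<Sum>i<N. c i * e' i x)" if h: "h \<in> polys s" for h
    proof -
      have "(\<lambda>x. h (L (x - (- K a)))) \<in> polys s" using L(1) h by (rule polys_compose_affine)
      from span[OF this] obtain c where c: "(\<lambda>x. h (L (x - (- K a)))) = (\<lambda>x. \<Sum>i<N. c i * e i x)" ..
      have "h y = (\<Sum>i<N. c i * e' i y)" for y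
        using fun_cong[OF c, of "K (y - a)"] K(3) linear_diff[OF K(1), of y a] by (simp add: e'_def)
      then have "h = (\<lambda>x. \<Sum>i<N. c i * e' i x)" by (rule ext)
      then show ?thesis by (rule exI[where x = c])
    qed
    moreover have "\<bar>e' i x\<bar> \<le> M" if "i < N" "x \<in> B" for i x
    proof -
      obtain z where "z \<in> ?U" "x = a + L z" using \<open>x \<in> B\<close> unfolding B by blast
      then have "\<bar>e' i x\<bar> \<le> m i" using m(2)[OF that(1)] by (simp add: e'_def K(2))
      also have "\<dots> \<le> M" using that(1) by (rule mM)
      finally show ?thesis .
    qed
    ultimately show "\<exists>e. orthonormal_basis s B N e \<and> (\<forall>i<N. \<forall>x\<in>B. \<bar>e i x\<bar> \<le> M)"
      unfolding orthonormal_basis_def orthonormal_polys_def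
      by (intro exI[of _ e'] conjI allI impI ballI)
  qed
qed

lemma polys_expansion:
  fixes h :: "real^'n \<Rightarrow> 'a::{real_normed_field,euclidean_space}"
  assumes e: "orthonormal_basis s B N e" and h: "h \<in> polys s"
  obtains c where "h = (\<lambda>x. \<Sum>i<N. c i * of_real (e i x))"
proof -
  obtain k where k: "h = (\<lambda>x. \<Sum>\<alpha> | sum \<alpha> UNIV \<le> s. k \<alpha> * of_real (monomial_fun \<alpha> x))"
    using polysE[OF h] .
  have "\<forall>\<alpha>\<in>{\<alpha>. sum \<alpha> UNIV \<le> s}. \<exists>c. monomial_fun \<alpha> = (\<lambda>x. \<Sum>i<N. c i * e i x)"
  proof
    fix \<alpha> :: "'n \<Rightarrow> nat" assume "\<alpha> \<in> {\<alpha>. sum \<alpha> UNIV \<le> s}"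
    then have "monomial_fun \<alpha> \<in> polys s" using polys_monomial[of \<alpha> s "1::real"] by simp
    then show "\<exists>c. monomial_fun \<alpha> = (\<lambda>x. \<Sum>i<N. c i * e i x)"
      using e unfolding orthonormal_basis_def by blast
  qed
  from bchoice[OF this] obtain c
    where c: "monomial_fun \<alpha> = (\<lambda>x. \<Sum>i<N. c \<alpha> i * e i x)" if "sum \<alpha> UNIV \<le> s" for \<alpha>
    by blast
  have "h x = (\<Sum>i<N. (\<Sum>\<alpha> | sum \<alpha> UNIV \<le> s. k \<alpha> * of_real (c \<alpha> i)) * of_real (e i x))" for x
  proof -
    have "h x = (\<Sum>\<alpha> | sum \<alpha> UNIV \<le> s. \<Sum>i<N. k \<alpha> * of_real (c \<alpha> i) * of_real (e i x))"
      unfolding k by (intro sum.cong refl) (simp add: c sum_distrib_left mult.assoc)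
    also have "\<dots> = (\<Sum>i<N. \<Sum>\<alpha> | sum \<alpha> UNIV \<le> s. k \<alpha> * of_real (c \<alpha> i) * of_real (e i x))"
      by (rule sum.swap)
    finally show ?thesis by (simp only: sum_distrib_right)
  qed
  then have "h = (\<lambda>x. \<Sum>i<N. (\<Sum>\<alpha> | sum \<alpha> UNIV \<le> s. k \<alpha> * of_real (c \<alpha> i)) * of_real (e i x))"
    by (rule ext)
  then show ?thesis by (rule that)
qed

section \<open>The projection is a near-best approximation\<close>

text \<open>The Fourier sum has the defining orthogonality property, as all Fourier coefficients of its residual
  vanish. Conversely, testing orthogonality against the basis forces the coefficients of any candidate, so the
  definite description denotes this polynomial.\<close>

lemma poly_proj_eq_Fourier_sum:
  fixes g :: "real^'n \<Rightarrow> 'a::{real_normed_field,euclidean_space}"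
  assumes B: "ellipsoid B" and e: "orthonormal_basis s B N e" and g: "set_integrable lebesgue B g"
  shows "poly_proj s B g = (\<lambda>x. \<Sum>i<N. avg B (\<lambda>y. g y * of_real (e i y)) * of_real (e i x))"
    (is "_ = ?Q")
  unfolding poly_proj_def avg_eq_0_iff[OF B, symmetric]
proof (rule the_equality, safe)
  have on: "orthonormal_polys s B N e" and ep: "\<And>i. i < N \<Longrightarrow> e i \<in> polys s"
    using e unfolding orthonormal_basis_def orthonormal_polys_def by auto
  show Q: "?Q \<in> polys s" by (intro polys_sum polys_cmult polys_of_real ep) simp
  {
    fix h :: "real^'n \<Rightarrow> 'a" assume "h \<in> polys s"
    then obtain d where d: "h = (\<lambda>x. \<Sum>i<N. d i * of_real (e i x))" using polys_expansion[OF e] by blast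
    have gQ: "set_integrable lebesgue B (\<lambda>x. g x - ?Q x)"
      using g set_integrable_polys[OF B Q] by (rule set_integral_diff)
    have int: "set_integrable lebesgue B (\<lambda>x. d j * ((g x - ?Q x) * of_real (e j x)))" if "j < N" for j
      by (intro set_integrable_mult_right impI set_integrable_mult_polys[OF B gQ polys_of_real[OF ep[OF that]]])
    have "avg B (\<lambda>x. (g x - ?Q x) * h x) = avg B (\<lambda>x. \<Sum>j<N. d j * ((g x - ?Q x) * of_real (e j x)))"
      unfolding d sum_distrib_left by (simp only: mult.left_commute)
    also have "\<dots> = (\<Sum>j<N. avg B (\<lambda>x. d j * ((g x - ?Q x) * of_real (e j x))))"
      by (rule avg_sum, rule int) simp
    also have "\<dots> = 0"
      unfolding avg_cmult by (intro sum.neutral) (simp add: avg_expansion_residual[OF B on g])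
    finally show "avg B (\<lambda>x. (g x - ?Q x) * h x) = 0" .
  }
  fix f assume "f \<in> polys s" and ort: "\<forall>h\<in>polys s. avg B (\<lambda>x. (g x - f x) * h x) = 0"
  then obtain c where c: "f = (\<lambda>x. \<Sum>i<N. c i * of_real (e i x))" using polys_expansion[OF e] by blast
  have "c j = avg B (\<lambda>x. g x * of_real (e j x))" if "j < N" for j
  proof -
    have "avg B (\<lambda>x. (g x - f x) * of_real (e j x)) = 0"
      by (rule bspec[OF ort polys_of_real[OF ep[OF that]]])
    then show ?thesis unfolding c avg_expansion_residual[OF B on g that] by simp
  qed
  then show "f = ?Q" unfolding c by (intro ext sum.cong) auto
qed

lemma Lq_mean_eq_avg: "Lq_mean q B g = avg B (\<lambda>x. norm (g x) powr q) powr (1 / q)"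
  by (simp add: Lq_mean_def avg_def divide_inverse_commute)

lemma powr_add_le:
  fixes a b q :: real
  assumes "0 \<le> a" "0 \<le> b" "0 \<le> q"
  shows "(a + b) powr q \<le> 2 powr q * (a powr q + b powr q)"
proof -
  have "(a + b) powr q \<le> (2 * max a b) powr q" using assms by (intro powr_mono2) auto
  also have "\<dots> = 2 powr q * max a b powr q" using assms by (simp add: powr_mult)
  also have "max a b powr q \<le> a powr q + b powr q" by (simp add: max_def)
  finally show ?thesis by simp
qed

lemma set_integrable_of_powr:
  fixes u :: "real^'n \<Rightarrow> 'a::euclidean_space"
  assumes B: "ellipsoid B" and u: "u \<in> borel_measurable lebesgue"
    and int: "set_integrable lebesgue B (\<lambda>x. norm (u x) powr q)" and q: "1 \<le> q"
  shows "set_integrable lebesgue B u"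
proof (rule set_integrable_bound)
  show "set_integrable lebesgue B (\<lambda>x. 1 + norm (u x) powr q)"
    using set_integrable_const_ellipsoid[OF B] int by (rule set_integral_add)
  show "set_borel_measurable lebesgue B u"
    using u ellipsoid_sets[OF B] unfolding set_borel_measurable_def by measurable
  have "t \<le> 1 + t powr q" if "0 \<le> t" for t :: real
  proof (cases "t \<le> 1")
    case False
    then have "t powr 1 \<le> t powr q" using q by (intro powr_mono) auto
    then show ?thesis using False by simp
  qed (use powr_ge_zero[of t q] in linarith)
  then show "AE x in lebesgue. x \<in> B \<longrightarrow> norm (u x) \<le> norm (1 + norm (u x) powr q)"
    by (simp add: abs_of_nonneg add_nonneg_nonneg)
qed

lemma Lq_loc_diff_polys:
  fixes f P :: "real^'n \<Rightarrow> 'a::{real_normed_field,euclidean_space}"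
  assumes B: "ellipsoid B" and f: "f \<in> Lq_loc q" and P: "P \<in> polys s" and q: "1 \<le> q"
  shows "(\<lambda>x. f x - P x) \<in> borel_measurable lebesgue"
    and "set_integrable lebesgue B (\<lambda>x. norm (f x - P x) powr q)"
proof -
  have fm [measurable]: "f \<in> borel_measurable lebesgue"
    and fi: "set_integrable lebesgue (closure B) (\<lambda>x. norm (f x) powr q)"
    using f bounded_ellipsoid[OF B] unfolding Lq_loc_def by auto
  have [measurable]: "P \<in> borel_measurable lebesgue" using P by (rule borel_measurable_polys)
  have [measurable]: "B \<in> sets lebesgue" using B by simp
  show "(\<lambda>x. f x - P x) \<in> borel_measurable lebesgue" by measurable
  obtain M where M: "0 \<le> M" "\<And>x. x \<in> B \<Longrightarrow> norm (P x) \<le> M"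
    using polys_bounded[OF bounded_ellipsoid[OF B] P] by blast
  show "set_integrable lebesgue B (\<lambda>x. norm (f x - P x) powr q)"
  proof (rule set_integrable_bound)
    have "set_integrable lebesgue B (\<lambda>x. norm (f x) powr q)"
      using fi ellipsoid_sets[OF B] closure_subset by (rule set_integrable_subset)
    then show "set_integrable lebesgue B (\<lambda>x. 2 powr q * (norm (f x) powr q + M powr q))"
      by (intro set_integrable_mult_right impI set_integral_add set_integrable_const_ellipsoid[OF B])
    show "set_borel_measurable lebesgue B (\<lambda>x. norm (f x - P x) powr q)"
      unfolding set_borel_measurable_def by measurable
    show "AE x in lebesgue. x \<in> B \<longrightarrow> norm (norm (f x - P x) powr q)
        \<le> norm (2 powr q * (norm (f x) powr q + M powr q))"
    proof (intro AE_I2 impI)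
      fix x assume "x \<in> B"
      have "norm (f x - P x) \<le> norm (f x) + M" using M(2)[OF \<open>x \<in> B\<close>] norm_triangle_ineq4[of "f x" "P x"] by simp
      then have "norm (f x - P x) powr q \<le> (norm (f x) + M) powr q" using q by (intro powr_mono2) auto
      also have "\<dots> \<le> 2 powr q * (norm (f x) powr q + M powr q)" using M q by (intro powr_add_le) auto
      finally show "norm (norm (f x - P x) powr q) \<le> norm (2 powr q * (norm (f x) powr q + M powr q))" by simp
    qed
  qed
qed

lemma poly_proj_in_polys:
  fixes g :: "real^'n \<Rightarrow> 'a::{real_normed_field,euclidean_space}"
  assumes B: "ellipsoid B" and g: "set_integrable lebesgue B g"
  shows "poly_proj s B g \<in> polys s"
proof -
  obtain N e where e: "orthonormal_basis s B N e" using orthonormal_basis_exists[OF B] .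
  then have "\<And>i. i < N \<Longrightarrow> e i \<in> polys s" unfolding orthonormal_basis_def orthonormal_polys_def by blast
  then show ?thesis unfolding poly_proj_eq_Fourier_sum[OF B e g]
    by (intro polys_sum polys_cmult polys_of_real) simp
qed

text \<open>The projection fixes \<open>P\<close>, so \<open>P - poly_proj s B g\<close> is minus the Fourier sum of \<open>g - P\<close>, and each
  of its \<open>N\<close> terms is bounded by an average of \<open>|g - P|\<close> times the square of the bound \<open>M\<close> of the basis.\<close>

lemma poly_proj_deviation:
  fixes g P :: "real^'n \<Rightarrow> 'a::{real_normed_field,euclidean_space}"
  assumes B: "ellipsoid B" and e: "orthonormal_basis s B N e"
    and M: "0 \<le> M" "\<And>i x. i < N \<Longrightarrow> x \<in> B \<Longrightarrow> \<bar>e i x\<bar> \<le> M"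
    and g: "set_integrable lebesgue B g" and P: "P \<in> polys s" and x: "x \<in> B"
  shows "norm (P x - poly_proj s B g x) \<le> real N * M * M * avg B (\<lambda>y. norm (g y - P y))"
proof -
  have on: "orthonormal_polys s B N e" and ep: "\<And>i. i < N \<Longrightarrow> e i \<in> polys s"
    using e unfolding orthonormal_basis_def orthonormal_polys_def by blast+
  obtain c where c: "P = (\<lambda>x. \<Sum>i<N. c i * of_real (e i x))" using polys_expansion[OF e P] .
  define d where "d i = avg B (\<lambda>y. (g y - P y) * of_real (e i y))" for i
  let ?a = "avg B (\<lambda>y. norm (g y - P y))"
  have gP: "set_integrable lebesgue B (\<lambda>y. g y - P y)"
    using g set_integrable_polys[OF B P] by (rule set_integral_diff)
  have ngP: "set_integrable lebesgue B (\<lambda>y. norm (g y - P y))"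
    using gP by (rule set_integrable_norm)
  have d: "norm (d i) \<le> M * ?a" if i: "i < N" for i
  proof -
    have "norm (d i) \<le> avg B (\<lambda>y. M * norm (g y - P y))"
      unfolding d_def
    proof (rule norm_avg_le)
      show "set_integrable lebesgue B (\<lambda>y. (g y - P y) * of_real (e i y))"
        by (rule set_integrable_mult_polys[OF B gP polys_of_real[OF ep[OF i]]])
      show "set_integrable lebesgue B (\<lambda>y. M * norm (g y - P y))"
        using ngP by (rule set_integrable_mult_right)
      fix y assume "y \<in> B"
      then have "norm (g y - P y) * \<bar>e i y\<bar> \<le> norm (g y - P y) * M" using M i by (intro mult_left_mono) auto
      then show "norm ((g y - P y) * of_real (e i y)) \<le> M * norm (g y - P y)"
        by (simp add: norm_mult mult.commute)
    qed
    then show ?thesis by (simp only: avg_cmult)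
  qed
  have di: "d i = avg B (\<lambda>y. g y * of_real (e i y)) - c i" if "i < N" for i
    using avg_expansion_residual[OF B on g that, of c] unfolding d_def c .
  have "P x - poly_proj s B g x = (\<Sum>i<N. c i * of_real (e i x)) - (\<Sum>i<N. (d i + c i) * of_real (e i x))"
    unfolding poly_proj_eq_Fourier_sum[OF B e g] c by (simp add: di)
  also have "\<dots> = (\<Sum>i<N. - d i * of_real (e i x))"
    unfolding sum_subtractf[symmetric] by (intro sum.cong refl) (simp add: algebra_simps)
  finally have "norm (P x - poly_proj s B g x) \<le> (\<Sum>i<N. norm (- d i * of_real (e i x)))"
    by (simp only: norm_sum)
  also have "\<dots> \<le> (\<Sum>i<N. (M * ?a) * M)"
  proof (rule sum_mono)
    fix i assume "i \<in> {..<N}"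
    moreover have "0 \<le> M * ?a" using M(1) by (intro mult_nonneg_nonneg avg_nonneg) simp_all
    ultimately have "norm (d i) * \<bar>e i x\<bar> \<le> (M * ?a) * M" using M x d[of i]
      by (intro mult_mono) auto
    then show "norm (- d i * of_real (e i x)) \<le> (M * ?a) * M" by (simp add: norm_mult)
  qed
  also have "\<dots> = real N * M * M * ?a" by simp
  finally show ?thesis .
qed

text \<open>The sum \<open>u + w\<close> is split by \<open>(a + b)^q \<le> 2^q (a^q + b^q)\<close>, and the comparison of the first with the
  \<open>q\<close>-th mean follows from \<open>t \<le> m + m^(1-q) t^q\<close>. The latter needs \<open>m > 0\<close>, hence all \<open>m\<close> strictly above the
  \<open>q\<close>-mean are considered, which also covers the case that the mean is zero.\<close>

lemma Lq_mean_perturbation: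
  fixes u w :: "real^'n \<Rightarrow> 'a::{real_normed_field,euclidean_space}"
  assumes B: "ellipsoid B" and q: "1 \<le> q" and K: "0 \<le> K"
    and u: "u \<in> borel_measurable lebesgue" "set_integrable lebesgue B (\<lambda>x. norm (u x) powr q)"
    and w: "\<And>x. x \<in> B \<Longrightarrow> norm (w x) \<le> K * avg B (\<lambda>y. norm (u y))"
  shows "Lq_mean q B (\<lambda>x. u x + w x) \<le> 2 * (1 + (2 * K) powr q) powr (1 / q) * Lq_mean q B u"
proof -
  define C where "C = 2 * (1 + (2 * K) powr q) powr (1 / q)"
  have "0 < 1 + (2 * K) powr q" using powr_ge_zero[of "2*K" q] by linarith
  then have C: "0 < C" "C powr q = 2 powr q * (1 + (2 * K) powr q)"
    using q by (auto simp: C_def powr_mult powr_powr)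
  have "Lq_mean q B (\<lambda>x. u x + w x) / C \<le> m" if m: "Lq_mean q B u < m" for m
  proof -
    have "0 \<le> Lq_mean q B u" by (simp add: Lq_mean_def)
    then have m0: "0 < m" using m by linarith
    let ?I = "avg B (\<lambda>x. norm (u x) powr q)"
    have "0 \<le> ?I" by (rule avg_nonneg) simp
    then have "?I = (?I powr (1 / q)) powr q" using q by (simp add: powr_powr)
    also have "\<dots> \<le> m powr q" using m q by (intro powr_mono2) (auto simp: Lq_mean_eq_avg)
    finally have I: "?I \<le> m powr q" .
    have "avg B (\<lambda>x. norm (u x)) \<le> avg B (\<lambda>x. m + m powr (1 - q) * norm (u x) powr q)"
    proof (rule avg_mono)
      show "set_integrable lebesgue B (\<lambda>x. m + m powr (1 - q) * norm (u x) powr q)"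
        by (intro set_integral_add set_integrable_const_ellipsoid[OF B] set_integrable_mult_right impI u)
      fix x
      show "0 \<le> m + m powr (1 - q) * norm (u x) powr q" using m0 by (intro add_nonneg_nonneg) auto
      show "norm (u x) \<le> m + m powr (1 - q) * norm (u x) powr q"
      proof (cases "norm (u x) \<le> m")
        case False
        then have "norm (u x) = norm (u x) powr (1 - q) * norm (u x) powr q"
          using m0 by (simp add: powr_add[symmetric])
        \<comment> \<open>The exponent \<open>1 - q\<close> is nonpositive, so the larger base gives the smaller power.\<close>
        also have "\<dots> \<le> m powr (1 - q) * norm (u x) powr q"
          using False q m0 by (intro mult_right_mono powr_mono2') auto
        finally show ?thesis using m0 by simp
      qed (use m0 in \<open>auto intro: add_increasing2\<close>)
    qed
    also have "\<dots> = m + m powr (1 - q) * ?I"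
    proof -
      have "avg B (\<lambda>x. m + m powr (1 - q) * norm (u x) powr q)
          = avg B (\<lambda>x. m) + avg B (\<lambda>x. m powr (1 - q) * norm (u x) powr q)"
        by (intro avg_add set_integrable_const_ellipsoid[OF B] set_integrable_mult_right impI u)
      then show ?thesis by (simp add: avg_const[OF B] avg_cmult)
    qed
    also have "\<dots> \<le> m + m powr (1 - q) * m powr q" using I by (intro add_left_mono mult_left_mono) auto
    also have "\<dots> = 2 * m" using m0 by (simp add: powr_add[symmetric])
    finally have a: "avg B (\<lambda>x. norm (u x)) \<le> 2 * m" .
    have "avg B (\<lambda>x. norm (u x + w x) powr q)
        \<le> avg B (\<lambda>x. 2 powr q * (norm (u x) powr q + (2 * K * m) powr q))"
    proof (rule avg_mono)
      show "set_integrable lebesgue B (\<lambda>x. 2 powr q * (norm (u x) powr q + (2 * K * m) powr q))"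
        by (intro set_integral_add set_integrable_const_ellipsoid[OF B] set_integrable_mult_right impI u)
      fix x
      show "0 \<le> 2 powr q * (norm (u x) powr q + (2 * K * m) powr q)"
        by (intro mult_nonneg_nonneg add_nonneg_nonneg) auto
      assume x: "x \<in> B"
      have "K * avg B (\<lambda>y. norm (u y)) \<le> K * (2 * m)" using a K by (rule mult_left_mono)
      then have "norm (u x + w x) \<le> norm (u x) + 2 * K * m"
        using norm_triangle_ineq[of "u x" "w x"] w[OF x] by (simp add: algebra_simps)
      then have "norm (u x + w x) powr q \<le> (norm (u x) + 2 * K * m) powr q"
        using q by (intro powr_mono2) auto
      also have "\<dots> \<le> 2 powr q * (norm (u x) powr q + (2 * K * m) powr q)"
        using K m0 q by (intro powr_add_le) auto
      finally show "norm (u x + w x) powr q \<le> 2 powr q * (norm (u x) powr q + (2 * K * m) powr q)" .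
    qed
    also have "\<dots> = 2 powr q * (?I + (2 * K * m) powr q)"
      unfolding avg_cmult avg_add[OF u(2) set_integrable_const_ellipsoid[OF B]] avg_const[OF B] ..
    also have "\<dots> \<le> 2 powr q * (m powr q + (2 * K) powr q * m powr q)"
      using I m0 K by (intro mult_left_mono add_mono) (auto simp: powr_mult)
    also have "\<dots> = (C * m) powr q" using C m0 by (simp add: powr_mult algebra_simps)
    finally have "Lq_mean q B (\<lambda>x. u x + w x) \<le> ((C * m) powr q) powr (1 / q)"
      unfolding Lq_mean_eq_avg using q by (intro powr_mono2 avg_nonneg) auto
    also have "\<dots> = C * m" using C m0 q by (simp add: powr_powr)
    finally show ?thesis using C by (simp add: field_simps)
  qed
  then have "Lq_mean q B (\<lambda>x. u x + w x) / C \<le> Lq_mean q B u" by (rule dense_ge)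
  then show ?thesis using C(1) unfolding C_def[symmetric] by (simp add: field_simps)
qed

text \<open>Split \<open>f - poly_proj s B f\<close> as \<open>(f - P) + (P - poly_proj s B f)\<close>. The second part is bounded through the size \<open>N\<close>
  and the bound \<open>M\<close> of an orthonormal basis, and these two numbers serve every ellipsoid.\<close>

lemma poly_proj_near_best:
  assumes q: "1 \<le> q"
  obtains C :: real where "0 < C"
    "\<And>(B :: (real^'n) set) (f :: real^'n \<Rightarrow> 'a::{real_normed_field,euclidean_space}) P.
       ellipsoid B \<Longrightarrow> f \<in> Lq_loc q \<Longrightarrow> P \<in> polys s \<Longrightarrow>
       poly_proj s B f \<in> polys s \<and>
       Lq_mean q B (\<lambda>x. f x - poly_proj s B f x) \<le> C * Lq_mean q B (\<lambda>x. f x - P x)"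
proof -
  obtain N M where M: "0 \<le> M"
    "\<And>B :: (real^'n) set. ellipsoid B \<Longrightarrow>
       \<exists>e. orthonormal_basis s B N e \<and> (\<forall>i<N. \<forall>x\<in>B. \<bar>e i x\<bar> \<le> M)"
    by (rule uniformly_bounded_orthonormal_bases[of s]) (rule that)
  define K where "K = real N * M * M"
  have K: "0 \<le> K" using M(1) by (simp add: K_def)
  show thesis
  proof (rule that[of "2 * (1 + (2 * K) powr q) powr (1 / q)"])
    have "0 < 1 + (2 * K) powr q" using powr_ge_zero[of "2*K" q] by linarith
    then show "0 < 2 * (1 + (2 * K) powr q) powr (1 / q)" by simp
    fix B :: "(real^'n) set" and f P :: "real^'n \<Rightarrow> 'a"
    assume B: "ellipsoid B" and f: "f \<in> Lq_loc q" and P: "P \<in> polys s"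
    from M(2)[OF B] obtain e
      where "orthonormal_basis s B N e \<and> (\<forall>i<N. \<forall>x\<in>B. \<bar>e i x\<bar> \<le> M)" ..
    then have e: "orthonormal_basis s B N e" "\<And>i x. i < N \<Longrightarrow> x \<in> B \<Longrightarrow> \<bar>e i x\<bar> \<le> M"
      by simp_all
    note u = Lq_loc_diff_polys[OF B f P q]
    have fi: "set_integrable lebesgue B f"
      using set_integrable_of_powr[OF B Lq_loc_diff_polys[OF B f polys_zero q] q] by simp
    have "Lq_mean q B (\<lambda>x. (f x - P x) + (P x - poly_proj s B f x))
        \<le> 2 * (1 + (2 * K) powr q) powr (1 / q) * Lq_mean q B (\<lambda>x. f x - P x)"
      using poly_proj_deviation[OF B e(1) M(1) e(2) fi P] unfolding K_def[symmetric]
      by (intro Lq_mean_perturbation[OF B q K u]) simp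
    then show "poly_proj s B f \<in> polys s \<and> Lq_mean q B (\<lambda>x. f x - poly_proj s B f x)
        \<le> 2 * (1 + (2 * K) powr q) powr (1 / q) * Lq_mean q B (\<lambda>x. f x - P x)"
      using poly_proj_in_polys[OF B fi] by simp
  qed
qed

section \<open>Dilated balls are ellipsoids\<close>

lemma linear_inj_funpow:
  fixes L :: "'a::euclidean_space \<Rightarrow> 'a"
  assumes "linear L" "inj L" shows "linear (L ^^ k) \<and> inj (L ^^ k)"
proof (induction k)
  case 0
  show ?case using linear_ident by (simp add: id_def)
next
  case (Suc k)
  then show ?case unfolding funpow.simps(2) using assms linear_compose inj_compose by blast
qed

lemma inj_matrix_inv:
  fixes A :: "real^'n^'n"
  assumes "invertible A" shows "matrix_inv A ** A = mat 1" "inj ((*v) (matrix_inv A))"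
proof -
  have *: "A ** matrix_inv A = mat 1 \<and> matrix_inv A ** A = mat 1"
    using assms unfolding invertible_def matrix_inv_def by (rule someI_ex)
  then show "matrix_inv A ** A = mat 1" ..
  show "inj ((*v) (matrix_inv A))" using * matrix_left_invertible_injective by blast
qed

text \<open>The matrix \<open>A\<close> is injective because the open set \<open>\<Delta>\<close> is contained in \<open>A \<Delta>\<close>, while the image under a
  singular map is a null set.\<close>

lemma dil_balls_ellipsoid:
  fixes A :: "real^'n^'n"
  assumes setting: "dilation_setting A \<Delta> r" and B: "B \<in> dil_balls A \<Delta>"
  shows "ellipsoid B"
proof -
  obtain P :: "real^'n^'n" where P: "invertible P" "\<Delta> = {x. norm (P *v x) < 1}"
    using setting unfolding dilation_setting_def centred_open_ellipsoid_def by blast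
  have "\<Delta> = (\<lambda>x. 0 + matrix_inv P *v x) ` ball 0 1"
  proof -
    have "P ** matrix_inv P = mat 1"
      using inj_matrix_inv(1)[OF P(1)] matrix_left_right_inverse by blast
    then have 1: "P *v (matrix_inv P *v x) = x" and 2: "matrix_inv P *v (P *v x) = x" for x
      using inj_matrix_inv(1)[OF P(1)] by (simp_all add: matrix_vector_mul_assoc)
    show ?thesis unfolding P(2)
    proof (intro set_eqI iffI)
      fix x assume "x \<in> {x. norm (P *v x) < 1}"
      then have "P *v x \<in> ball 0 1" "x = 0 + matrix_inv P *v (P *v x)" by (simp_all add: 2)
      then show "x \<in> (\<lambda>x. 0 + matrix_inv P *v x) ` ball 0 1" by (rule rev_image_eqI)
    qed (auto simp: 1)
  qed
  then have \<Delta>: "ellipsoid \<Delta>"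
    using ellipsoid_image[OF ellipsoid_unit_ball, of "(*v) (matrix_inv P)" 0] inj_matrix_inv(2)[OF P(1)]
    by simp
  have "inj ((*v) A)"
  proof (rule ccontr)
    assume "\<not> inj ((*v) A)"
    then have "negligible ((*v) A ` \<Delta>)" by (intro negligible_linear_singular_image) auto
    moreover have "\<Delta> \<subseteq> (*v) A ` \<Delta>" using setting unfolding dilation_setting_def by blast
    ultimately have "negligible \<Delta>" by (rule negligible_subset)
    then show False using open_not_negligible open_ellipsoid[OF \<Delta>] ellipsoid_nonempty[OF \<Delta>] by blast
  qed
  moreover from this have "inj ((*v) (matrix_inv A))"
    by (intro inj_matrix_inv) (simp add: invertible_left_inverse matrix_left_invertible_injective)
  ultimately have dil: "linear (dil_pow A k)" "inj (dil_pow A k)" for k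
    unfolding dil_pow_def using linear_inj_funpow[of "(*v) A"] linear_inj_funpow[of "(*v) (matrix_inv A)"] by simp_all
  obtain x k where "B = (\<lambda>y. x + y) ` (dil_pow A k ` \<Delta>)" using B unfolding dil_balls_def by blast
  then have "B = (\<lambda>y. x + dil_pow A k y) ` \<Delta>" by (simp add: image_image)
  then show ?thesis using ellipsoid_image[OF \<Delta> dil] by simp
qed

section \<open>Comparison of the two Campanato norms\<close>

lemma ennreal_one_le_inverse:
  fixes x :: ennreal assumes "x \<le> 1" shows "1 \<le> inverse x"
proof (cases x)
  case (real r)
  then have "r \<le> 1" using assms by (simp add: ennreal_le_1)
  then show ?thesis using real
    by (cases "r = 0") (simp_all add: inverse_ennreal one_le_inverse ennreal_ge_1)
qed (use assms in \<open>simp add: top_unique\<close>)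

lemma ennreal_inverse_mult_le_one: "inverse x * x \<le> (1 :: ennreal)"
proof (cases x)
  case (real r)
  then show ?thesis
    by (cases "r = 0") (simp_all add: inverse_ennreal ennreal_mult[symmetric])
qed simp

context
  fixes A :: "real^'n^'n" and \<Delta> :: "(real^'n) set" and r :: real
    and p :: "real^'n \<Rightarrow> ereal" and a q \<eta> :: real
  assumes setting: "dilation_setting A \<Delta> r" and p: "exponent_at_most_one p a"
    and q: "1 \<le> q" and \<eta>: "0 < \<eta>" "\<eta> \<le> 1"
begin

interpretation exponent_at_most_one p a by (rule p)

text \<open>The family consisting of one ball with coefficient one already gives the bound: its denominator is
  the norm of \<open>1\<^sub>B / \<parallel>1\<^sub>B\<parallel>\<close>, and the projection competes in the infimum over all polynomials.\<close>

lemma campanato_norm_le_type_norm: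
  fixes f :: "real^'n \<Rightarrow> 'a::{real_normed_field,euclidean_space}"
  assumes f: "f \<in> Lq_loc q"
  shows "campanato_norm A \<Delta> p q s f \<le> campanato_type_norm A \<Delta> p q s \<eta> f"
  unfolding campanato_norm_def
proof (rule SUP_least)
  fix B assume B: "B \<in> dil_balls A \<Delta>"
  then have el: "ellipsoid B" by (rule dil_balls_ellipsoid[OF setting])
  have fi: "set_integrable lebesgue B f"
    using set_integrable_of_powr[OF el Lq_loc_diff_polys[OF el f polys_zero q] q] by simp
  let ?n = "ind_norm p B"
  let ?v = "measure lebesgue B / ?n * Lq_mean q B (\<lambda>x. f x - poly_proj s B f x)"
  note n = varLp_norm_indicator[OF lmeasurable_ellipsoid[OF el] measure_ellipsoid_pos[OF el]]
  let ?g = "\<lambda>x. (\<Sum>i=1..(1::nat). (1 / ?n) powr \<eta> * indicat_real B x) powr (1 / \<eta>)"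
  have "?g = (\<lambda>x. indicat_real B x / ?n)"
    using n \<eta> by (auto simp: fun_eq_iff indicator_def powr_powr)
  then have "varLp_norm p ?g \<le> 1"
    using varLp_norm_normalised_indicator[OF lmeasurable_ellipsoid[OF el] measure_ellipsoid_pos[OF el]] by simp
  then have inv: "1 \<le> inverse (varLp_norm p ?g)"
    by (rule ennreal_one_le_inverse)
  have "(INF P\<in>polys s. ennreal (measure lebesgue B / ?n * Lq_mean q B (\<lambda>x. f x - P x))) \<le> ennreal ?v"
    by (rule INF_lower[OF poly_proj_in_polys[OF el fi]])
  also have "\<dots> = 1 * ennreal ?v" by simp
  also have "\<dots> \<le> inverse (varLp_norm p ?g) * ennreal ?v" using inv by (rule mult_right_mono) simp
  also have "\<dots> = inverse (varLp_norm p ?g) * ennreal (\<Sum>j=1..(1::nat). 1 * measure lebesgue B / ?n *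
         Lq_mean q B (\<lambda>x. f x - poly_proj s B f x))" by simp
  also have "\<dots> \<le> campanato_type_norm A \<Delta> p q s \<eta> f"
    unfolding campanato_type_norm_def
    by (rule Sup_upper, intro CollectI exI[of _ "1::nat"] exI[of _ "\<lambda>_. B"] exI[of _ "\<lambda>_. 1::real"])
       (use B in simp)
  finally show "(INF P\<in>polys s. ennreal (measure lebesgue B / ?n * Lq_mean q B (\<lambda>x. f x - P x)))
      \<le> campanato_type_norm A \<Delta> p q s \<eta> f" .
qed

text \<open>Each oscillation is at most \<open>C\<close> times the Campanato norm because the projection is near-best; the
  remaining factor, the sum of the coefficients, is bounded by the norm in the denominator by superadditivity.\<close>

lemma campanato_type_norm_le:
  obtains C :: real where "0 < C"
    "\<And>f :: real^'n \<Rightarrow> 'a::{real_normed_field,euclidean_space}. f \<in> Lq_loc q \<Longrightarrow>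
       campanato_type_norm A \<Delta> p q s \<eta> f \<le> ennreal C * campanato_norm A \<Delta> p q s f"
proof -
  obtain C :: real where C: "0 < C"
    "\<And>(B :: (real^'n) set) (f :: real^'n \<Rightarrow> 'a) P.
       ellipsoid B \<Longrightarrow> f \<in> Lq_loc q \<Longrightarrow> P \<in> polys s \<Longrightarrow>
       poly_proj s B f \<in> polys s \<and>
       Lq_mean q B (\<lambda>x. f x - poly_proj s B f x) \<le> C * Lq_mean q B (\<lambda>x. f x - P x)"
    by (rule poly_proj_near_best[OF q]) (rule that)
  show thesis
  proof (rule that[OF C(1)])
    fix f :: "real^'n \<Rightarrow> 'a" assume f: "f \<in> Lq_loc q"
    let ?N = "campanato_norm A \<Delta> p q s f"
    define osc where "osc B = measure lebesgue B / ind_norm p B *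
         Lq_mean q B (\<lambda>x. f x - poly_proj s B f x)" for B
    have osc: "ennreal (osc B) \<le> ennreal C * ?N" and osc0: "0 \<le> osc B" if B: "B \<in> dil_balls A \<Delta>" for B
    proof -
      have el: "ellipsoid B" using B by (rule dil_balls_ellipsoid[OF setting])
      note n = varLp_norm_indicator[OF lmeasurable_ellipsoid[OF el] measure_ellipsoid_pos[OF el]]
      have w: "0 \<le> measure lebesgue B / ind_norm p B" using n by simp
      have "0 \<le> Lq_mean q B (\<lambda>x. f x - poly_proj s B f x)" by (simp add: Lq_mean_def)
      then show "0 \<le> osc B" unfolding osc_def using w by (rule mult_nonneg_nonneg[rotated])
      have "ennreal (osc B / C) \<le> (INF P\<in>polys s.
          ennreal (measure lebesgue B / ind_norm p B * Lq_mean q B (\<lambda>x. f x - P x)))"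
      proof (rule INF_greatest)
        fix P :: "real^'n \<Rightarrow> 'a" assume "P \<in> polys s"
        from C(2)[OF el f this] have "osc B \<le> measure lebesgue B / ind_norm p B * (C * Lq_mean q B (\<lambda>x. f x - P x))"
          unfolding osc_def using w by (intro mult_left_mono) auto
        then have "osc B / C \<le> measure lebesgue B / ind_norm p B * Lq_mean q B (\<lambda>x. f x - P x)"
          using C(1) by (simp add: field_simps)
        then show "ennreal (osc B / C) \<le> ennreal (measure lebesgue B / ind_norm p B * Lq_mean q B (\<lambda>x. f x - P x))"
          by (rule ennreal_leI)
      qed
      also have "\<dots> \<le> ?N" unfolding campanato_norm_def using B by (rule SUP_upper)
      finally have "ennreal C * ennreal (osc B / C) \<le> ennreal C * ?N" by (rule mult_left_mono) simp
      then show "ennreal (osc B) \<le> ennreal C * ?N"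
        using C(1) \<open>0 \<le> osc B\<close> by (simp add: ennreal_mult[symmetric])
    qed
    show "campanato_type_norm A \<Delta> p q s \<eta> f \<le> ennreal C * ?N"
      unfolding campanato_type_norm_def
    proof (rule Sup_least, clarify)
      fix m :: nat and B :: "nat \<Rightarrow> (real^'n) set" and lam :: "nat \<Rightarrow> real"
      assume B: "\<forall>j\<in>{1..m}. B j \<in> dil_balls A \<Delta>" and lam: "\<forall>j\<in>{1..m}. 0 \<le> lam j"
        and ne: "(\<Sum>j=1..m. lam j) \<noteq> 0"
      have el: "ellipsoid (B j)" if "j \<in> {1..m}" for j using B that dil_balls_ellipsoid[OF setting] by blast
      let ?G = "varLp_norm p (\<lambda>x. (\<Sum>i=1..m. (lam i / ind_norm p (B i)) powr \<eta> * indicat_real (B i) x) powr (1 / \<eta>))"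
      have G: "ennreal (\<Sum>j=1..m. lam j) \<le> ?G"
        using lam el \<eta> by (intro sum_le_varLp_norm lmeasurable_ellipsoid measure_ellipsoid_pos) auto
      have "ennreal (\<Sum>j=1..m. lam j * measure lebesgue (B j) / ind_norm p (B j) *
          Lq_mean q (B j) (\<lambda>x. f x - poly_proj s (B j) f x)) = ennreal (\<Sum>j=1..m. lam j * osc (B j))"
        by (simp add: osc_def mult.assoc)
      also have "\<dots> = (\<Sum>j=1..m. ennreal (lam j) * ennreal (osc (B j)))"
        using lam B osc0 by (subst sum_ennreal[symmetric]) (auto intro!: sum.cong ennreal_mult)
      also have "\<dots> \<le> (\<Sum>j=1..m. ennreal (lam j) * (ennreal C * ?N))"
        using B osc by (intro sum_mono mult_left_mono) auto
      also have "\<dots> = ennreal (\<Sum>j=1..m. lam j) * (ennreal C * ?N)"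
        using lam by (subst sum_ennreal[symmetric]) (simp_all add: sum_distrib_right)
      also have "\<dots> \<le> ?G * (ennreal C * ?N)" using G by (rule mult_right_mono) simp
      finally have le: "inverse ?G * ennreal (\<Sum>j=1..m. lam j * measure lebesgue (B j) / ind_norm p (B j) *
          Lq_mean q (B j) (\<lambda>x. f x - poly_proj s (B j) f x)) \<le> inverse ?G * (?G * (ennreal C * ?N))"
        by (rule mult_left_mono) simp
      have "inverse ?G * ?G \<le> 1"
        by (rule ennreal_inverse_mult_le_one)
      then have "inverse ?G * (?G * (ennreal C * ?N)) \<le> 1 * (ennreal C * ?N)"
        unfolding mult.assoc[symmetric] by (intro mult_right_mono) auto
      with le show "inverse ?G * ennreal (\<Sum>j=1..m. lam j * measure lebesgue (B j) / ind_norm p (B j) *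
          Lq_mean q (B j) (\<lambda>x. f x - poly_proj s (B j) f x)) \<le> ennreal C * ?N" by simp
    qed
  qed
qed

end

theorem proposition2p8:
  fixes A :: "real^'n^'n" and \<Delta> :: "(real^'n) set" and r\<^sub>0 :: real
    and p :: "real^'n \<Rightarrow> ereal" and q \<eta> :: real and s :: nat
  assumes "dilation_setting A \<Delta> r\<^sub>0"
    and "p \<in> variable_exponents" and "0 < p_plus p" and "p_plus p \<le> 1"
    and "1 \<le> q" and "0 < \<eta>" and "\<eta> \<le> 1"
  shows "(campanato_type_space A \<Delta> p q s \<eta> :: (real^'n \<Rightarrow> 'a::{real_normed_field,euclidean_space}) set)
           = campanato_space A \<Delta> p q s \<and>
         (\<exists>c C::real. 0 < c \<and> 0 < C \<and>
            (\<forall>f::real^'n \<Rightarrow> 'a. f \<in> campanato_space A \<Delta> p q s \<longrightarrow>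
               ennreal c * campanato_norm A \<Delta> p q s f \<le> campanato_type_norm A \<Delta> p q s \<eta> f \<and>
               campanato_type_norm A \<Delta> p q s \<eta> f \<le> ennreal C * campanato_norm A \<Delta> p q s f))"
proof -
  obtain a where p: "exponent_at_most_one p a"
    using variable_exponents_le_one[OF assms(2,4)] .
  have lower: "campanato_norm A \<Delta> p q s f \<le> campanato_type_norm A \<Delta> p q s \<eta> f"
    if "f \<in> Lq_loc q" for f :: "real^'n \<Rightarrow> 'a"
    using campanato_norm_le_type_norm[OF assms(1) p assms(5-7) that] .
  obtain C :: real where C: "0 < C" and upper: "\<And>f :: real^'n \<Rightarrow> 'a. f \<in> Lq_loc q \<Longrightarrow>
      campanato_type_norm A \<Delta> p q s \<eta> f \<le> ennreal C * campanato_norm A \<Delta> p q s f"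
    by (rule campanato_type_norm_le[OF assms(1) p assms(5-7)]) (rule that)
  have "campanato_type_norm A \<Delta> p q s \<eta> f < \<infinity> \<longleftrightarrow> campanato_norm A \<Delta> p q s f < \<infinity>"
    if f: "f \<in> Lq_loc q" for f :: "real^'n \<Rightarrow> 'a"
  proof
    assume "campanato_type_norm A \<Delta> p q s \<eta> f < \<infinity>"
    with lower[OF f] show "campanato_norm A \<Delta> p q s f < \<infinity>" by (rule le_less_trans)
  next
    assume "campanato_norm A \<Delta> p q s f < \<infinity>"
    then have "ennreal C * campanato_norm A \<Delta> p q s f < \<infinity>" by (simp add: ennreal_mult_less_top)
    with upper[OF f] show "campanato_type_norm A \<Delta> p q s \<eta> f < \<infinity>" by (rule le_less_trans)
  qed
  then have "(campanato_type_space A \<Delta> p q s \<eta> :: (real^'n \<Rightarrow> 'a) set) = campanato_space A \<Delta> p q s"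
    unfolding campanato_type_space_def campanato_space_def by blast
  moreover have "\<exists>c C::real. 0 < c \<and> 0 < C \<and>
            (\<forall>f::real^'n \<Rightarrow> 'a. f \<in> campanato_space A \<Delta> p q s \<longrightarrow>
               ennreal c * campanato_norm A \<Delta> p q s f \<le> campanato_type_norm A \<Delta> p q s \<eta> f \<and>
               campanato_type_norm A \<Delta> p q s \<eta> f \<le> ennreal C * campanato_norm A \<Delta> p q s f)"
    using C lower upper by (intro exI[of _ 1] exI[of _ C]) (simp add: campanato_space_def)
  ultimately show ?thesis by blast
qed

end
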